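(* Let $\lambda_1,\lambda_2,\mu>0$ with $\rho=(\lambda_1+\lambda_2)/\mu<1$, and consider the two-class non-preemptive priority M/M/1 queue with arrival rates $\lambda_1,\lambda_2$ and common service rate $\mu$, with stationary probabilities $p_{ijk}$. For $|z_2|<1$ let $f(z_2)$ denote the unique root $z_1$ in the disc $|z_1|<1$ of $$\lambda_1 z_1^2-[\lambda_1+\lambda_2(1-z_2)+\mu]z_1+\mu=0 .$$ Put $$F^1(z_1,z_2)=\sum_{i=1}^\infty\sum_{j=0}^\infty p_{ij1}z_1^iz_2^j,\qquad F^2(z_1,z_2)=\sum_{i=0}^\infty\sum_{j=1}^\infty p_{ij2}z_1^iz_2^j,\qquad F_0^2(z_2)=\sum_{j=1}^\infty p_{0j2}z_2^j .$$ Then $p_{000}=\dfrac{\mu-\lambda_1-\lambda_2}{\mu}$, and for all complex $z_1,z_2$ with $0<|z_1|<1$, $0<|z_2|<1$ and $z_1\neq f(z_2)$, $$F_0^2(z_2)=\frac{[\lambda_1(1-f(z_2))+\lambda_2(1-z_2)+\mu]\,[\lambda_1(1-f(z_2))+\lambda_2(1-z_2)]}{\left[\frac{\mu}{z_2}-\big(\lambda_1(1-f(z_2))+\lambda_2(1-z_2)+\mu\big)\right][\lambda_1+\lambda_2(1-z_2)+\mu]}\;p_{000},$$ $$F^2(z_1,z_2)=\frac{[\lambda_1+\lambda_2(1-z_2)+\mu]\,F_0^2(z_2)}{\lambda_1(1-z_1)+\lambda_2(1-z_2)+\mu},$$ $$F^1(z_1,z_2)=\frac{[\lambda_1+\lambda_2(1-z_2)+\mu]\left(\frac{\mu}{z_2}\cdot\frac{1}{\lambda_1(1-z_1)+\lambda_2(1-z_2)+\mu}-1\right)F_0^2(z_2)-[\lambda_1(1-z_1)+\lambda_2(1-z_2)]\,p_{000}}{\lambda_1(1-z_1)+\lambda_2(1-z_2)+\mu\left(1-\frac1{z_1}\right)},$$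 and the joint generating function of the numbers of class-1 and class-2 customers in the system in stationarity is $F(z_1,z_2)=F^1(z_1,z_2)+F^2(z_1,z_2)+p_{000}$.
   Context: Model. A single server with infinite buffer serves two classes of customers. Class-1 and class-2 customers arrive according to independent Poisson processes with rates $\lambda_1$ and $\lambda_2$; all service times are independent, exponential with mean $1/\mu$, and independent of the arrivals. Class-1 customers have non-preemptive priority over class-2 customers: a service in progress is never interrupted, and upon each service completion the server takes a class-1 customer if one is present, otherwise a class-2 customer if one is present, otherwise it becomes free; a customer arriving to a free server starts service at once; within a class the order is first come, first served. $N_i(t)$ is the number of class-$i$ customers in the system (including the one in service) at time $t$, and $\xi(t)\in\{0,1,2\}$ is $0$ if the server is free, and $1$ or $2$ if it is serving a class-1 or class-2 customer. $(N_1(t),N_2(t),\xi(t))$ is a continuous-time Markov chain on the states $(0,0,0)$; $(i,j,1)$ with $i\ge1,j\ge0$; $(i,j,2)$ with $i\ge0,j\ge1$. Its transitions are: - from $(0,0,0)$ to $(1,0,1)$ at rate $\lambda_1$ and to $(0,1,2)$ at rate $\lambda_2$; - from $(i,j,k)$ with $k\in\{1,2\}$ to $(i+1,j,k)$ at rate $\lambda_1$ and to $(i,j+1,k)$ at rate $\lambda_2$; - from $(i,j,1)$ at rate $\mu$ to $(i-1,j,k')$, and from $(i,j,2)$ at rate $\mu$ to $(i,j-1,k')$, where, for the new numbers $(i',j')$ of customers, $k'=1$ if $i'\ge1$, $k'=2$ if $i'=0,j'\ge1$, and $k'=0$ if $i'=j'=0$. The stationary probabilities are $p_{ijk}=\lim_{t\to\infty}\Pr\{N_1(t)=i,N_2(t)=j,\xi(t)=k\}$.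 *)

theory Defs
  imports "HOL-Probability.Probability"
begin

section \<open>Continuous-time Markov chains with given transition rates\<close>

text \<open>
  \<open>P t x y\<close> is the probability of being in \<open>y\<close> a time \<open>t\<close> after being in \<open>x\<close>;
  the third conjunct is the Chapman-Kolmogorov equation.
\<close>

definition transition_function :: "'s set \<Rightarrow> (real \<Rightarrow> 's \<Rightarrow> 's \<Rightarrow> real) \<Rightarrow> bool" where
  "transition_function S P \<longleftrightarrow>
     (\<forall>t\<ge>0. \<forall>x\<in>S. (\<forall>y\<in>S. 0 \<le> P t x y) \<and> (P t x has_sum 1) S) \<and>
     (\<forall>x\<in>S. \<forall>y\<in>S. P 0 x y = of_bool (x = y)) \<and>
     (\<forall>s\<ge>0. \<forall>t\<ge>0. \<forall>x\<in>S. \<forall>y\<in>S. ((\<lambda>z. P s x z * P t z y) has_sum P (s + t) x y) S)"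

text \<open>
  The rates \<open>r x y\<close> are meaningful for \<open>x \<noteq> y\<close> only; the diagonal of the generator
  makes its rows sum to zero.
\<close>

definition generator :: "'s set \<Rightarrow> ('s \<Rightarrow> 's \<Rightarrow> real) \<Rightarrow> 's \<Rightarrow> 's \<Rightarrow> real" where
  "generator S r x y = (if x = y then - (\<Sum>\<^sub>\<infinity>z\<in>S - {x}. r x z) else r x y)"

definition has_transition_rates ::
    "'s set \<Rightarrow> ('s \<Rightarrow> 's \<Rightarrow> real) \<Rightarrow> (real \<Rightarrow> 's \<Rightarrow> 's \<Rightarrow> real) \<Rightarrow> bool" where
  "has_transition_rates S r P \<longleftrightarrow>
     (\<forall>x\<in>S. \<forall>y\<in>S. ((\<lambda>h. (P h x y - of_bool (x = y)) / h) \<longlongrightarrow> generator S r x y) (at_right 0))"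

text \<open>
  The Markov property is stated without conditional probabilities, so that conditioning
  events of probability zero need no convention. The initial distribution is arbitrary.
\<close>

definition markov_chain ::
    "'s set \<Rightarrow> ('s \<Rightarrow> 's \<Rightarrow> real) \<Rightarrow> 'w measure \<Rightarrow> (real \<Rightarrow> 'w \<Rightarrow> 's) \<Rightarrow> bool" where
  "markov_chain S r M X \<longleftrightarrow>
     prob_space M \<and>
     (\<forall>t\<ge>0. X t \<in> measurable M (count_space S)) \<and>
     (\<exists>P. transition_function S P \<and> has_transition_rates S r P \<and>
        (\<forall>s\<ge>0. \<forall>t\<ge>0. \<forall>x\<in>S. \<forall>y\<in>S. \<forall>T g. finite T \<and> T \<subseteq> {0..<s} \<longrightarrow>
           measure M {w \<in> space M. (\<forall>u\<in>T. X u w = g u) \<and> X s w = x \<and> X (s + t) w = y} =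
           measure M {w \<in> space M. (\<forall>u\<in>T. X u w = g u) \<and> X s w = x} * P t x y))"


section \<open>The two-class non-preemptive priority M/M/1 queue\<close>

definition queue_states :: "(nat \<times> nat \<times> nat) set" where
  "queue_states = {(0, 0, 0)} \<union> {(i, j, 1) | i j. 1 \<le> i} \<union> {(i, j, 2) | i j. 1 \<le> j}"

text \<open>The class taken into service when \<open>i\<close> and \<open>j\<close> customers are left behind; \<open>0\<close> if none.\<close>

definition next_class :: "nat \<Rightarrow> nat \<Rightarrow> nat" where
  "next_class i j = (if 1 \<le> i then 1 else if 1 \<le> j then 2 else 0)"

definition after_service :: "nat \<times> nat \<times> nat \<Rightarrow> nat \<times> nat \<times> nat" where
  "after_service = (\<lambda>(i, j, k).
     if k = 1 then (i - 1, j, next_class (i - 1) j) else (i, j - 1, next_class i (j - 1)))"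

definition queue_rate ::
    "real \<Rightarrow> real \<Rightarrow> real \<Rightarrow> nat \<times> nat \<times> nat \<Rightarrow> nat \<times> nat \<times> nat \<Rightarrow> real" where
  "queue_rate l1 l2 mu = (\<lambda>(i, j, k) y.
     if k = 0 then
       (if y = (1, 0, 1) then l1 else if y = (0, 1, 2) then l2 else 0)
     else
       (if y = (i + 1, j, k) then l1
        else if y = (i, j + 1, k) then l2
        else if y = after_service (i, j, k) then mu
        else 0))"

definition priority_queue ::
    "real \<Rightarrow> real \<Rightarrow> real \<Rightarrow> 'w measure \<Rightarrow> (real \<Rightarrow> 'w \<Rightarrow> nat) \<Rightarrow> (real \<Rightarrow> 'w \<Rightarrow> nat) \<Rightarrow>
     (real \<Rightarrow> 'w \<Rightarrow> nat) \<Rightarrow> bool" where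
  "priority_queue l1 l2 mu M N1 N2 xi \<longleftrightarrow>
     markov_chain queue_states (queue_rate l1 l2 mu) M (\<lambda>t w. (N1 t w, N2 t w, xi t w))"

definition prob_at ::
    "'w measure \<Rightarrow> (real \<Rightarrow> 'w \<Rightarrow> nat) \<Rightarrow> (real \<Rightarrow> 'w \<Rightarrow> nat) \<Rightarrow> (real \<Rightarrow> 'w \<Rightarrow> nat) \<Rightarrow>
     real \<Rightarrow> nat \<Rightarrow> nat \<Rightarrow> nat \<Rightarrow> real" where
  "prob_at M N1 N2 xi t i j k =
     measure M {w \<in> space M. N1 t w = i \<and> N2 t w = j \<and> xi t w = k}"

definition stationary_prob ::
    "'w measure \<Rightarrow> (real \<Rightarrow> 'w \<Rightarrow> nat) \<Rightarrow> (real \<Rightarrow> 'w \<Rightarrow> nat) \<Rightarrow> (real \<Rightarrow> 'w \<Rightarrow> nat) \<Rightarrow>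
     nat \<Rightarrow> nat \<Rightarrow> nat \<Rightarrow> real" where
  "stationary_prob M N1 N2 xi i j k = Lim at_top (\<lambda>t. prob_at M N1 N2 xi t i j k)"

definition numbers_prob_at ::
    "'w measure \<Rightarrow> (real \<Rightarrow> 'w \<Rightarrow> nat) \<Rightarrow> (real \<Rightarrow> 'w \<Rightarrow> nat) \<Rightarrow> real \<Rightarrow> nat \<Rightarrow> nat \<Rightarrow> real" where
  "numbers_prob_at M N1 N2 t i j = measure M {w \<in> space M. N1 t w = i \<and> N2 t w = j}"

definition stationary_numbers_prob ::
    "'w measure \<Rightarrow> (real \<Rightarrow> 'w \<Rightarrow> nat) \<Rightarrow> (real \<Rightarrow> 'w \<Rightarrow> nat) \<Rightarrow> nat \<Rightarrow> nat \<Rightarrow> real" where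
  "stationary_numbers_prob M N1 N2 i j = Lim at_top (\<lambda>t. numbers_prob_at M N1 N2 t i j)"


section \<open>Generating functions\<close>

definition joint_pgf :: "(nat \<Rightarrow> nat \<Rightarrow> real) \<Rightarrow> complex \<Rightarrow> complex \<Rightarrow> complex" where
  "joint_pgf a z1 z2 = (\<Sum>\<^sub>\<infinity>(i, j)\<in>UNIV. of_real (a i j) * z1 ^ i * z2 ^ j)"

definition pgf_class1 :: "(nat \<Rightarrow> nat \<Rightarrow> nat \<Rightarrow> real) \<Rightarrow> complex \<Rightarrow> complex \<Rightarrow> complex" where
  "pgf_class1 p z1 z2 = (\<Sum>\<^sub>\<infinity>(i, j)\<in>{1..} \<times> {0..}. of_real (p i j 1) * z1 ^ i * z2 ^ j)"

definition pgf_class2 :: "(nat \<Rightarrow> nat \<Rightarrow> nat \<Rightarrow> real) \<Rightarrow> complex \<Rightarrow> complex \<Rightarrow> complex" where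
  "pgf_class2 p z1 z2 = (\<Sum>\<^sub>\<infinity>(i, j)\<in>{0..} \<times> {1..}. of_real (p i j 2) * z1 ^ i * z2 ^ j)"

definition pgf_class2_alone :: "(nat \<Rightarrow> nat \<Rightarrow> nat \<Rightarrow> real) \<Rightarrow> complex \<Rightarrow> complex" where
  "pgf_class2_alone p z2 = (\<Sum>\<^sub>\<infinity>j\<in>{1..}. of_real (p 0 j 2) * z2 ^ j)"

definition is_disc_root :: "real \<Rightarrow> real \<Rightarrow> real \<Rightarrow> complex \<Rightarrow> complex \<Rightarrow> bool" where
  "is_disc_root l1 l2 mu z2 z1 \<longleftrightarrow>
     norm z1 < 1 \<and> l1 * z1 ^ 2 - (l1 + l2 * (1 - z2) + mu) * z1 + mu = 0"

definition disc_root :: "real \<Rightarrow> real \<Rightarrow> real \<Rightarrow> complex \<Rightarrow> complex" where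
  "disc_root l1 l2 mu z2 = (THE z1. is_disc_root l1 l2 mu z2 z1)"

end

theory Submission
  imports Defs
begin

text \<open>
  Every transition of the queue applies one of three maps to the state: an arrival of class 1, an
  arrival of class 2, or a service completion. If the completion map is also applied, at rate
  \<open>mu\<close> and without effect, to the empty state, then the three maps act at the same rates
  \<open>l1\<close>, \<open>l2\<close>, \<open>mu\<close> in every state. The process is thus a discrete chain observed at the points
  of a Poisson process of rate \<open>theta = l1 + l2 + mu\<close>; in each step of that chain one of the three
  maps is drawn with probability \<open>l1 / theta\<close>, \<open>l2 / theta\<close>, \<open>mu / theta\<close>.
  
  \<^bold>\<open>Convergence.\<close> Two copies of the discrete chain driven by the same draws have headcounts that go up
  and down together, and once the larger headcount is zero both copies are empty and stay equal. The
  larger headcount is a random walk with negative drift because \<open>l1 + l2 < mu\<close>, so it fails to reach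
  zero within \<open>n\<close> steps with a probability that decays geometrically (\<open>jump_iter_coupling\<close>). Hence
  the iterates of the averaging operator \<open>jump\<close> on a function of moderate growth converge
  geometrically to a constant, its stationary \<open>mean\<close>, which \<open>jump\<close> preserves (\<open>mean_jump\<close>).
  The limiting probability of a state is the mean of its indicator, called its \<open>weight\<close>.
  
  \<^bold>\<open>Back to continuous time.\<close> A transition function with the given rates solves Kolmogorov's backward
  equation (\<open>P_backward\<close>). Taylor's formula turns this into
  \<open>exp (theta * t) * P t x y = (\<Sum>n. (jump ^^ n) 1\<^sub>y x * (theta * t) ^ n / fact n)\<close>
  (\<open>uniformization\<close>), where \<open>1\<^sub>y\<close> is the indicator of \<open>y\<close>, and the geometric rate of the jump chain
  becomes an exponential rate in \<open>t\<close>.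
  
  \<^bold>\<open>The formulas.\<close> Applying \<open>mean_jump\<close> to three test functions gives everything. The
  headcount, which changes on average by a constant except at the empty state, gives \<open>p 0 0 0\<close>. The function
  \<open>z1 ^ i * z2 ^ j\<close> restricted to class 2 in service gives the second formula, since a class-2
  customer starts service only when no class-1 customer is present, so that the inflow does not depend
  on \<open>z1\<close> (\<open>class2_balance\<close>). The unrestricted function \<open>z1 ^ i * z2 ^ j\<close> gives the
  third formula (\<open>total_balance\<close>). In that equation the coefficient of the class-1 generating function
  vanishes at \<open>z1 = f z2\<close>, and what remains there determines \<open>F\<^sub>0\<^sup>2\<close> (the kernel method,
  \<open>generating_functions\<close>).
\<close>

section \<open>Transitions as three maps of the state\<close>

type_synonym state = "nat \<times> nat \<times> nat"

definition arrive1 :: "state \<Rightarrow> state" where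
  "arrive1 = (\<lambda>(i, j, k). (i + 1, j, if k = 0 then 1 else k))"

definition arrive2 :: "state \<Rightarrow> state" where
  "arrive2 = (\<lambda>(i, j, k). (i, j + 1, if k = 0 then 2 else k))"

definition headcount :: "state \<Rightarrow> nat" where
  "headcount = (\<lambda>(i, j, k). i + j)"

lemma queue_states_iff:
  "(i, j, k) \<in> queue_states \<longleftrightarrow>
     (k = 0 \<and> i = 0 \<and> j = 0) \<or> (k = 1 \<and> 1 \<le> i) \<or> (k = 2 \<and> 1 \<le> j)"
  by (auto simp: queue_states_def)

lemma empty_state [simp]: "(0, 0, 0) \<in> queue_states"
  by (simp add: queue_states_iff)

lemma step_in_states [simp]:
  assumes "x \<in> queue_states"
  shows "arrive1 x \<in> queue_states" "arrive2 x \<in> queue_states" "after_service x \<in> queue_states"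
  using assms
  by (cases x; auto simp: queue_states_iff arrive1_def arrive2_def after_service_def next_class_def)+

lemma headcount_step [simp]:
  "headcount (arrive1 x) = headcount x + 1" "headcount (arrive2 x) = headcount x + 1"
  "x \<in> queue_states \<Longrightarrow> headcount (after_service x) = headcount x - 1"
  by (cases x; auto simp: queue_states_iff arrive1_def arrive2_def after_service_def headcount_def)+

lemma headcount_eq_0: "x \<in> queue_states \<Longrightarrow> headcount x = 0 \<longleftrightarrow> x = (0, 0, 0)"
  by (cases x; auto simp: queue_states_iff headcount_def)

lemma geometric_Cauchy:
  fixes a :: "nat \<Rightarrow> 'b::banach"
  assumes a: "\<And>n. norm (a (Suc n) - a n) \<le> B * q ^ n" and q: "0 < q" "q < 1"
  shows "convergent a" "norm (a n - lim a) \<le> B / (1 - q) * q ^ n"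
proof -
  have B: "B \<ge> 0"
    using order_trans[OF norm_ge_zero a[of 0]] by simp
  have near: "norm (a (m + k) - a m) \<le> B / (1 - q) * q ^ m" for m k
  proof -
    have "norm (a (m + k) - a m) \<le> B / (1 - q) * q ^ m * (1 - q ^ k)"
    proof (induction k)
      case (Suc k)
      have "norm (a (m + Suc k) - a m) \<le> norm (a (Suc (m + k)) - a (m + k)) + norm (a (m + k) - a m)"
        using norm_triangle_ineq[of "a (Suc (m + k)) - a (m + k)" "a (m + k) - a m"] by simp
      also have "\<dots> \<le> B * q ^ (m + k) + B / (1 - q) * q ^ m * (1 - q ^ k)"
        by (intro add_mono a Suc.IH)
      also have "\<dots> = B / (1 - q) * q ^ m * (1 - q ^ Suc k)"
        using q by (simp add: power_add field_simps)
      finally show ?case .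
    qed simp
    also have "\<dots> \<le> B / (1 - q) * q ^ m"
      using B q by (intro mult_left_le) (auto intro!: mult_nonneg_nonneg)
    finally show ?thesis .
  qed
  have "(\<lambda>n. B * q ^ n) sums (B * (1 / (1 - q)))"
    using q by (intro sums_mult geometric_sums) auto
  then have "summable (\<lambda>n. a (Suc n) - a n)"
    using a by (meson summable_comparison_test' sums_summable)
  then have "convergent (\<lambda>n. \<Sum>k<n. a (Suc k) - a k)"
    by (simp add: summable_iff_convergent)
  then have "convergent (\<lambda>n. (a n - a 0) + a 0)"
    by (intro convergent_add convergent_const) (simp add: sum_lessThan_telescope)
  then show "convergent a" by simp
  then have "(\<lambda>k. a (k + n)) \<longlonglongrightarrow> lim a"
    by (intro LIMSEQ_ignore_initial_segment) (simp add: convergent_LIMSEQ_iff)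
  then have "(\<lambda>k. norm (a n - a (k + n))) \<longlonglongrightarrow> norm (a n - lim a)"
    by (intro tendsto_intros)
  then show "norm (a n - lim a) \<le> B / (1 - q) * q ^ n"
  proof (rule LIMSEQ_le_const2)
    show "\<exists>N. \<forall>k\<ge>N. norm (a n - a (k + n)) \<le> B / (1 - q) * q ^ n"
      using near[of n] by (metis add.commute norm_minus_commute)
  qed
qed

section \<open>The jump chain and its coupling\<close>

locale stable_queue =
  fixes l1 l2 mu :: real
  assumes l1: "l1 > 0" and l2: "l2 > 0" and mu: "mu > 0" and stable: "l1 + l2 < mu"
begin

definition theta :: real where
  "theta = l1 + l2 + mu"

text \<open>
  The one-step averaging operator of the discrete chain; \<open>(jump ^^ n) f x\<close> is the expectation of \<open>f\<close>
  after \<open>n\<close> steps from \<open>x\<close>. The values of \<open>f\<close> are vectors so that real test functions (headcount,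
  indicators) and complex ones (monomials) are treated alike.
\<close>

definition jump :: "(state \<Rightarrow> 'b::banach) \<Rightarrow> state \<Rightarrow> 'b" where
  "jump f x = (l1 *\<^sub>R f (arrive1 x) + l2 *\<^sub>R f (arrive2 x) + mu *\<^sub>R f (after_service x)) /\<^sub>R theta"

text \<open>
  A walk that steps up at rate \<open>l1 + l2\<close> and down at rate \<open>mu\<close> multiplies \<open>r ^ m\<close> on average by
  \<open>((l1 + l2) * r + mu / r) / theta\<close> per step; the value chosen for \<open>radius\<close> minimises this factor.
\<close>

definition radius :: real where
  "radius = sqrt (mu / (l1 + l2))"

definition decay :: real where
  "decay = ((l1 + l2) * radius + mu / radius) / theta"

text \<open>
  Growth up to \<open>radius ^ headcount\<close> is what the coupling can absorb. Bounded functions alone would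
  not do: the headcount itself serves as a test function.
\<close>

definition tame :: "(state \<Rightarrow> 'b::banach) \<Rightarrow> bool" where
  "tame f \<longleftrightarrow> (\<exists>C. \<forall>x\<in>queue_states. \<forall>y\<in>queue_states.
     norm (f x - f y) \<le> C * radius ^ max (headcount x) (headcount y))"

definition mean :: "(state \<Rightarrow> 'b::banach) \<Rightarrow> 'b" where
  "mean f = lim (\<lambda>n. (jump ^^ n) f (0, 0, 0))"

definition weight :: "state \<Rightarrow> real" where
  "weight y = mean (\<lambda>x. of_bool (x = y))"

lemma theta_pos: "theta > 0"
  using l1 l2 mu by (simp add: theta_def)

lemma radius_gt_1: "radius > 1"
  using l1 l2 stable by (simp add: radius_def)

lemma decay_pos: "decay > 0"
  using l1 l2 mu theta_pos radius_gt_1 by (simp add: decay_def divide_pos_pos add_pos_pos)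

text \<open>
  At \<open>r = radius\<close> one has \<open>theta * r - ((l1 + l2) * r ^ 2 + mu) = (l1 + l2) * r * (r - 1) ^ 2\<close>,
  because \<open>(l1 + l2) * r ^ 2 = mu\<close>.
\<close>

lemma decay_lt_1: "decay < 1"
proof -
  have "radius * radius = mu / (l1 + l2)"
    using l1 l2 mu by (simp add: radius_def)
  then have sq: "(l1 + l2) * (radius * radius) = mu"
    using l1 l2 by simp
  have "0 < (radius - 1) * ((l1 + l2) * radius * (radius - 1))"
    using radius_gt_1 l1 l2 by simp
  also have "\<dots> = theta * radius - ((l1 + l2) * (radius * radius) + mu)"
  proof -
    have "(radius - 1) * ((l1 + l2) * radius * (radius - 1)) =
        (l1 + l2) * (radius * radius) * (radius - 2) + (l1 + l2) * radius"
      by algebra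
    then show ?thesis
      unfolding sq theta_def by (simp add: algebra_simps)
  qed
  finally have "(l1 + l2) * (radius * radius) + mu < theta * radius"
    by simp
  then have "(l1 + l2) * radius + mu / radius < theta"
    using radius_gt_1 by (simp add: field_simps)
  then show ?thesis
    using theta_pos by (simp add: decay_def)
qed

lemma jump_cong:
  "(\<And>x. x \<in> queue_states \<Longrightarrow> f x = g x) \<Longrightarrow> x \<in> queue_states \<Longrightarrow> jump f x = jump g x"
  by (simp add: jump_def)

lemma jump_iter_cong:
  assumes "\<And>x. x \<in> queue_states \<Longrightarrow> f x = g x" "x \<in> queue_states"
  shows "(jump ^^ n) f x = (jump ^^ n) g x"
  using assms(2) by (induction n arbitrary: x) (auto intro!: jump_cong simp: assms(1))

lemma jump_const [simp]: "jump (\<lambda>_. c) x = c"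
proof -
  have "l1 *\<^sub>R c + l2 *\<^sub>R c + mu *\<^sub>R c = theta *\<^sub>R c"
    by (simp add: theta_def scaleR_add_left)
  then show ?thesis
    using theta_pos by (simp add: jump_def)
qed

lemma jump_iter_add: "(jump ^^ n) (\<lambda>x. f x + g x) = (\<lambda>x. (jump ^^ n) f x + (jump ^^ n) g x)"
  by (induction n) (auto simp: jump_def algebra_simps)

lemma jump_iter_bounded_linear:
  assumes "bounded_linear h"
  shows "(jump ^^ n) (\<lambda>x. h (f x)) = (\<lambda>x. h ((jump ^^ n) f x))"
proof -
  interpret bounded_linear h by fact
  show ?thesis
    by (induction n) (auto simp: jump_def add scaleR)
qed

lemma norm_jump_diff_le:
  assumes "norm (f (arrive1 x) - g (arrive1 y)) \<le> a" "norm (f (arrive2 x) - g (arrive2 y)) \<le> a"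
    "norm (f (after_service x) - g (after_service y)) \<le> b"
  shows "norm (jump f x - jump g y) \<le> ((l1 + l2) * a + mu * b) / theta"
proof -
  have "jump f x - jump g y =
      (l1 *\<^sub>R (f (arrive1 x) - g (arrive1 y)) + l2 *\<^sub>R (f (arrive2 x) - g (arrive2 y)) +
       mu *\<^sub>R (f (after_service x) - g (after_service y))) /\<^sub>R theta"
    by (simp add: jump_def algebra_simps)
  moreover have "norm (l1 *\<^sub>R (f (arrive1 x) - g (arrive1 y)) + l2 *\<^sub>R (f (arrive2 x) - g (arrive2 y)) +
       mu *\<^sub>R (f (after_service x) - g (after_service y))) \<le> l1 * a + l2 * a + mu * b"
    using assms l1 l2 mu by (intro norm_triangle_le add_mono) (auto intro!: mult_left_mono)
  moreover have "l1 * a + l2 * a + mu * b = (l1 + l2) * a + mu * b"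
    by (simp add: algebra_simps)
  ultimately show ?thesis
    using theta_pos by (simp add: divide_right_mono divide_inverse_commute[symmetric])
qed

lemma norm_jump_iter_le:
  assumes "\<And>x. x \<in> queue_states \<Longrightarrow> norm (f x) \<le> B" "x \<in> queue_states"
  shows "norm ((jump ^^ n) f x) \<le> B"
  using assms(2)
proof (induction n arbitrary: x)
  case (Suc n)
  have "norm (jump ((jump ^^ n) f) x - jump (\<lambda>_. 0) x) \<le> ((l1 + l2) * B + mu * B) / theta"
    by (rule norm_jump_diff_le) (use Suc in auto)
  then show ?case
    using theta_pos by (simp add: theta_def flip: distrib_right)
qed (use assms(1) in auto)

lemma jump_iter_nonneg:
  fixes f :: "state \<Rightarrow> real"
  assumes "\<And>x. f x \<ge> 0"
  shows "(jump ^^ n) f x \<ge> 0"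
proof (induction n arbitrary: x)
  case (Suc n)
  then show ?case
    using l1 l2 mu theta_pos by (simp add: jump_def)
qed (simp add: assms)

text \<open>
  The two copies are compared map by map, which is the synchronous coupling. An arrival raises both
  headcounts and a service lowers the larger one as long as it is positive, so the bound
  \<open>C * radius ^ m\<close> shrinks by the factor \<open>decay\<close> on average; at \<open>m = 0\<close> the two states coincide.
\<close>

lemma jump_iter_coupling:
  assumes "\<And>x y. x \<in> queue_states \<Longrightarrow> y \<in> queue_states \<Longrightarrow>
      norm (f x - f y) \<le> C * radius ^ max (headcount x) (headcount y)"
    and "x \<in> queue_states" "y \<in> queue_states"
  shows "norm ((jump ^^ n) f x - (jump ^^ n) f y) \<le> C * decay ^ n * radius ^ max (headcount x) (headcount y)"
  using assms(2,3)
proof (induction n arbitrary: x y)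
  case 0
  then show ?case using assms(1) by simp
next
  case (Suc n)
  have C: "C \<ge> 0"
    using assms(1)[of "(0, 0, 0)" "(0, 0, 0)"] by (simp add: headcount_def)
  define m where "m = max (headcount x) (headcount y)"
  show ?case
  proof (cases "m = 0")
    case True
    then have "x = y"
      using Suc.prems headcount_eq_0 by (auto simp: m_def)
    then show ?thesis
      using C decay_pos radius_gt_1 by simp
  next
    case False
    then obtain m' where m': "m = Suc m'"
      using not0_implies_Suc by blast
    have up: "max (headcount x + 1) (headcount y + 1) = m + 1" "max (headcount x - 1) (headcount y - 1) = m'"
      using m' by (auto simp: m_def)
    have "norm ((jump ^^ Suc n) f x - (jump ^^ Suc n) f y) \<le>
        ((l1 + l2) * (C * decay ^ n * radius ^ (m + 1)) + mu * (C * decay ^ n * radius ^ m')) / theta"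
      unfolding funpow.simps comp_def
    proof (rule norm_jump_diff_le)
      show "norm ((jump ^^ n) f (arrive1 x) - (jump ^^ n) f (arrive1 y)) \<le> C * decay ^ n * radius ^ (m + 1)"
        using Suc.IH[of "arrive1 x" "arrive1 y"] Suc.prems up by simp
      show "norm ((jump ^^ n) f (arrive2 x) - (jump ^^ n) f (arrive2 y)) \<le> C * decay ^ n * radius ^ (m + 1)"
        using Suc.IH[of "arrive2 x" "arrive2 y"] Suc.prems up by simp
      show "norm ((jump ^^ n) f (after_service x) - (jump ^^ n) f (after_service y))
          \<le> C * decay ^ n * radius ^ m'"
        using Suc.IH[of "after_service x" "after_service y"] Suc.prems up by simp
    qed
    also have "\<dots> = C * decay ^ n * radius ^ m * decay"
      using radius_gt_1 theta_pos by (simp add: decay_def m' field_simps)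
    finally show ?thesis
      by (simp add: m_def mult_ac)
  qed
qed

section \<open>Stationary means\<close>

text \<open>
  One step from the empty state leads to a state with at most one customer, so consecutive iterates at the
  empty state differ by what the coupling allows between those states; other starting states are then compared
  with the empty one.
\<close>

lemma jump_iter_geometric:
  assumes "tame f" "x \<in> queue_states"
  shows "\<exists>B. \<forall>n. norm ((jump ^^ n) f x - mean f) \<le> B * decay ^ n"
proof -
  obtain C where C: "\<And>x y. x \<in> queue_states \<Longrightarrow> y \<in> queue_states \<Longrightarrow>
      norm (f x - f y) \<le> C * radius ^ max (headcount x) (headcount y)"
    using assms(1) unfolding tame_def by blast
  have coupling: "norm ((jump ^^ n) f x - (jump ^^ n) f y) \<le> C * decay ^ n * radius ^ max (headcount x) (headcount y)"
    if "x \<in> queue_states" "y \<in> queue_states" for x y n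
    by (rule jump_iter_coupling[OF C that])
  define e :: state where "e = (0, 0, 0)"
  have e: "e \<in> queue_states" "after_service e = e" "headcount e = 0"
    by (auto simp: e_def after_service_def next_class_def headcount_def)
  have "norm ((jump ^^ Suc n) f e - (jump ^^ n) f e) \<le> (C * radius) * decay ^ n" for n
  proof -
    have "norm ((jump ^^ Suc n) f e - (jump ^^ n) f e) =
        norm (jump ((jump ^^ n) f) e - jump (\<lambda>_. (jump ^^ n) f e) e)"
      by simp
    also have "\<dots> \<le> ((l1 + l2) * (C * radius * decay ^ n) + mu * (C * radius * decay ^ n)) / theta"
    proof (rule norm_jump_diff_le)
      show "norm ((jump ^^ n) f (arrive1 e) - (jump ^^ n) f e) \<le> C * radius * decay ^ n"
        using coupling[of "arrive1 e" e n] e by (simp add: mult_ac)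
      show "norm ((jump ^^ n) f (arrive2 e) - (jump ^^ n) f e) \<le> C * radius * decay ^ n"
        using coupling[of "arrive2 e" e n] e by (simp add: mult_ac)
      show "norm ((jump ^^ n) f (after_service e) - (jump ^^ n) f e) \<le> C * radius * decay ^ n"
        using C[of e e] e radius_gt_1 decay_pos by simp
    qed
    also have "\<dots> = C * radius * decay ^ n"
      using theta_pos by (simp add: theta_def field_simps)
    finally show ?thesis .
  qed
  note cauchy = geometric_Cauchy(2)[OF this decay_pos decay_lt_1]
  have "norm ((jump ^^ n) f x - mean f) \<le> (C * radius ^ headcount x + C * radius / (1 - decay)) * decay ^ n" for n
  proof -
    have "norm ((jump ^^ n) f x - mean f) \<le>
        norm ((jump ^^ n) f x - (jump ^^ n) f e) + norm ((jump ^^ n) f e - mean f)"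
      using norm_triangle_ineq[of "(jump ^^ n) f x - (jump ^^ n) f e" "(jump ^^ n) f e - mean f"] by simp
    also have "\<dots> \<le> C * decay ^ n * radius ^ headcount x + C * radius / (1 - decay) * decay ^ n"
      using coupling[OF assms(2) e(1), of n] cauchy[of n] e(3)
      by (intro add_mono) (simp_all add: mean_def e_def)
    finally show ?thesis by (simp add: algebra_simps)
  qed
  then show ?thesis by blast
qed

lemma jump_iter_tendsto:
  assumes "tame f" "x \<in> queue_states"
  shows "(\<lambda>n. (jump ^^ n) f x) \<longlonglongrightarrow> mean f"
proof -
  obtain B where B: "\<And>n. norm ((jump ^^ n) f x - mean f) \<le> B * decay ^ n"
    using jump_iter_geometric[OF assms] by blast
  have "(\<lambda>n. B * decay ^ n) \<longlonglongrightarrow> 0"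
    using decay_pos decay_lt_1 tendsto_mult_right_zero[OF LIMSEQ_power_zero[of decay], of B] by simp
  then have "(\<lambda>n. (jump ^^ n) f x - mean f) \<longlonglongrightarrow> 0"
    by (rule Lim_null_comparison[rotated]) (simp add: B)
  then show ?thesis
    by (simp add: LIM_zero_iff)
qed

lemma mean_eqI: "tame f \<Longrightarrow> (\<lambda>n. (jump ^^ n) f (0, 0, 0)) \<longlonglongrightarrow> m \<Longrightarrow> mean f = m"
  by (metis LIMSEQ_unique jump_iter_tendsto empty_state)

lemma tame_bounded:
  assumes "\<And>x. x \<in> queue_states \<Longrightarrow> norm (f x) \<le> B"
  shows "tame f"
  unfolding tame_def
proof (intro exI ballI)
  fix x y :: state assume xy: "x \<in> queue_states" "y \<in> queue_states"
  have "norm (f x - f y) \<le> 2 * B"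
    using assms[OF xy(1)] assms[OF xy(2)] norm_triangle_ineq4[of "f x" "f y"] by simp
  also have "\<dots> \<le> 2 * B * radius ^ max (headcount x) (headcount y)"
    using order_trans[OF norm_ge_zero assms[OF xy(1)]] radius_gt_1
    by (simp add: mult_le_cancel_left1 one_le_power)
  finally show "norm (f x - f y) \<le> 2 * B * radius ^ max (headcount x) (headcount y)" .
qed

lemma tame_headcount: "tame (\<lambda>x. real (headcount x))"
  unfolding tame_def
proof (intro exI ballI)
  fix x y :: state
  have "norm (real (headcount x) - real (headcount y)) \<le> real (max (headcount x) (headcount y))"
    by auto
  also have "\<dots> \<le> 1 / (radius - 1) * radius ^ max (headcount x) (headcount y)"
    using Bernoulli_inequality[of "radius - 1" "max (headcount x) (headcount y)"] radius_gt_1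
    by (simp add: field_simps)
  finally show "norm (real (headcount x) - real (headcount y)) \<le> 1 / (radius - 1) * radius ^ max (headcount x) (headcount y)" .
qed

lemma tame_add:
  assumes "tame f" "tame g"
  shows "tame (\<lambda>x. f x + g x)"
proof -
  obtain C D where
    C: "\<And>x y. x \<in> queue_states \<Longrightarrow> y \<in> queue_states \<Longrightarrow> norm (f x - f y) \<le> C * radius ^ max (headcount x) (headcount y)" and
    D: "\<And>x y. x \<in> queue_states \<Longrightarrow> y \<in> queue_states \<Longrightarrow> norm (g x - g y) \<le> D * radius ^ max (headcount x) (headcount y)"
    using assms unfolding tame_def by meson
  show ?thesis
    unfolding tame_def
  proof (intro exI ballI)
    fix x y :: state assume xy: "x \<in> queue_states" "y \<in> queue_states"
    show "norm ((f x + g x) - (f y + g y)) \<le> (C + D) * radius ^ max (headcount x) (headcount y)"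
      using C[OF xy] D[OF xy] norm_diff_triangle_ineq[of "f x" "g x" "f y" "g y"]
      by (simp add: algebra_simps)
  qed
qed

lemma mean_add: "tame f \<Longrightarrow> tame g \<Longrightarrow> mean (\<lambda>x. f x + g x) = mean f + mean g"
  using tendsto_add[OF jump_iter_tendsto[of f "(0, 0, 0)"] jump_iter_tendsto[of g "(0, 0, 0)"]]
  by (simp add: mean_eqI tame_add jump_iter_add)

lemma tame_bounded_linear:
  assumes "bounded_linear h" "tame f"
  shows "tame (\<lambda>x. h (f x))"
proof -
  interpret bounded_linear h by fact
  obtain K where K: "K \<ge> 0" "\<And>z. norm (h z) \<le> norm z * K"
    using nonneg_bounded by blast
  obtain C where C: "\<And>x y. x \<in> queue_states \<Longrightarrow> y \<in> queue_states \<Longrightarrow>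
      norm (f x - f y) \<le> C * radius ^ max (headcount x) (headcount y)"
    using assms unfolding tame_def by meson
  show ?thesis
    unfolding tame_def
  proof (intro exI ballI)
    fix x y :: state assume xy: "x \<in> queue_states" "y \<in> queue_states"
    have "norm (h (f x) - h (f y)) \<le> norm (f x - f y) * K"
      using K(2)[of "f x - f y"] by (simp add: diff)
    also have "\<dots> \<le> C * radius ^ max (headcount x) (headcount y) * K"
      using C[OF xy] K(1) by (rule mult_right_mono)
    finally show "norm (h (f x) - h (f y)) \<le> C * K * radius ^ max (headcount x) (headcount y)"
      by (simp add: mult_ac)
  qed
qed

lemma mean_bounded_linear:
  assumes "bounded_linear h" "tame f"
  shows "mean (\<lambda>x. h (f x)) = h (mean f)"
  using bounded_linear.tendsto[OF assms(1) jump_iter_tendsto[OF assms(2) empty_state]] assms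
  by (simp add: mean_eqI tame_bounded_linear jump_iter_bounded_linear)

lemma mean_cong: "(\<And>x. x \<in> queue_states \<Longrightarrow> f x = g x) \<Longrightarrow> mean f = mean g"
  unfolding mean_def by (simp add: jump_iter_cong[of f g])

lemma mean_jump: "tame f \<Longrightarrow> mean (jump f) = mean f"
  using LIMSEQ_Suc[OF jump_iter_tendsto[of f "(0, 0, 0)"]]
  by (simp add: mean_def limI funpow_swap1)

lemma mean_const: "mean (\<lambda>_. c) = c"
proof -
  have "(jump ^^ n) (\<lambda>_. c) = (\<lambda>_. c)" for n
    by (induction n) auto
  then show ?thesis by (simp add: mean_def)
qed

lemma tame_jump:
  assumes "tame f"
  shows "tame (jump f)"
proof -
  obtain C where C: "\<And>x y. x \<in> queue_states \<Longrightarrow> y \<in> queue_states \<Longrightarrow>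
      norm (f x - f y) \<le> C * radius ^ max (headcount x) (headcount y)"
    using assms unfolding tame_def by blast
  show ?thesis
    unfolding tame_def using jump_iter_coupling[OF C, of _ _ 1]
    by (intro exI[of _ "C * decay"] ballI) simp
qed

lemma mean_scaleR: "tame f \<Longrightarrow> mean (\<lambda>x. c *\<^sub>R f x) = c *\<^sub>R mean f"
  by (rule mean_bounded_linear) (rule bounded_linear_scaleR_right)

lemma mean_mult:
  fixes f :: "state \<Rightarrow> complex"
  shows "tame f \<Longrightarrow> mean (\<lambda>x. c * f x) = c * mean f"
  by (rule mean_bounded_linear) (rule bounded_linear_mult_right)

lemma tame_mult:
  fixes f :: "state \<Rightarrow> complex"
  shows "tame f \<Longrightarrow> tame (\<lambda>x. c * f x)"
  by (rule tame_bounded_linear) (rule bounded_linear_mult_right)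

text \<open>
  Stationarity of \<open>mean\<close> with the rates in place of the probabilities; all balance equations are
  instances.
\<close>

lemma mean_rates:
  assumes "tame f"
  shows "mean (\<lambda>x. l1 *\<^sub>R f (arrive1 x) + l2 *\<^sub>R f (arrive2 x) + mu *\<^sub>R f (after_service x)) =
    theta *\<^sub>R mean f"
proof -
  have "(\<lambda>x. l1 *\<^sub>R f (arrive1 x) + l2 *\<^sub>R f (arrive2 x) + mu *\<^sub>R f (after_service x)) =
      (\<lambda>x. theta *\<^sub>R jump f x)"
    using theta_pos by (simp add: jump_def)
  then show ?thesis
    using assms by (simp add: mean_scaleR tame_jump mean_jump)
qed

lemma norm_mean_le:
  assumes "\<And>x. x \<in> queue_states \<Longrightarrow> norm (f x) \<le> B"
  shows "norm (mean f) \<le> B"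
  using assms
  by (intro tendsto_upperbound[OF tendsto_norm[OF jump_iter_tendsto[OF tame_bounded empty_state]]])
    (auto intro!: always_eventually norm_jump_iter_le)

lemma tame_indicator: "tame (\<lambda>x. of_bool (x = y) :: 'b::{banach,real_normed_algebra_1})"
  by (rule tame_bounded[of _ 1]) auto

lemma mean_indicator: "mean (\<lambda>x. of_bool (x = y)) = (of_real (weight y) :: complex)"
proof -
  have "mean (\<lambda>x. of_real (of_bool (x = y)) :: complex) = of_real (weight y)"
    unfolding weight_def
    by (rule mean_bounded_linear[OF bounded_linear_of_real tame_indicator])
  moreover have "(\<lambda>x::state. of_real (of_bool (x = y)) :: complex) = (\<lambda>x. of_bool (x = y))"
    by auto
  ultimately show ?thesis by simp
qed

lemma
  fixes f :: "state \<Rightarrow> complex"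
  assumes "finite F"
  shows tame_finite: "tame (\<lambda>x. if x \<in> F then f x else 0)"
    and mean_finite: "mean (\<lambda>x. if x \<in> F then f x else 0) = (\<Sum>y\<in>F. of_real (weight y) * f y)"
proof -
  have *: "tame (\<lambda>x. if x \<in> G then f x else 0)" if "finite G" for G
  proof (rule tame_bounded[of _ "\<Sum>y\<in>G. norm (f y)"])
    fix x show "norm (if x \<in> G then f x else 0) \<le> (\<Sum>y\<in>G. norm (f y))"
      using that member_le_sum[of x G "\<lambda>y. norm (f y)"] by (auto intro: sum_nonneg)
  qed
  show "tame (\<lambda>x. if x \<in> F then f x else 0)" by (rule *[OF assms])
  show "mean (\<lambda>x. if x \<in> F then f x else 0) = (\<Sum>y\<in>F. of_real (weight y) * f y)"
    using assms
  proof (induction F)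
    case empty
    then show ?case by (simp add: mean_const)
  next
    case (insert y F)
    have lin: "bounded_linear (\<lambda>r::real. of_real r * f y)"
      by (rule bounded_linear_mult_const[OF bounded_linear_of_real])
    have t: "tame (\<lambda>x::state. of_bool (x = y) :: real)"
      by (rule tame_bounded[of _ 1]) auto
    have "(\<lambda>x. if x \<in> insert y F then f x else 0) =
        (\<lambda>x. of_real (of_bool (x = y)) * f y + (if x \<in> F then f x else 0))"
      using insert.hyps by auto
    then show ?case
      using insert mean_add[OF tame_bounded_linear[OF lin t] *[of F]] mean_bounded_linear[OF lin t]
      by (simp add: weight_def)
  qed
qed

text \<open>
  For a function vanishing at infinity the stationary mean is its sum against the weights, because
  the part outside a large finite set is uniformly small. The monomials are of this kind inside the
  open bidisc.
\<close>

lemma has_sum_mean: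
  fixes f :: "state \<Rightarrow> complex"
  assumes vanish: "\<And>e. e > 0 \<Longrightarrow> finite {x \<in> queue_states. norm (f x) > e}"
    and "tame f"
  shows "((\<lambda>x. of_real (weight x) * f x) has_sum mean f) queue_states"
  unfolding has_sum_def tendsto_iff eventually_finite_subsets_at_top
proof (intro allI impI)
  fix e :: real assume e: "e > 0"
  let ?X = "{x \<in> queue_states. norm (f x) > e / 2}"
  show "\<exists>X. finite X \<and> X \<subseteq> queue_states \<and> (\<forall>Y. finite Y \<and> X \<subseteq> Y \<and> Y \<subseteq> queue_states \<longrightarrow>
      dist (\<Sum>x\<in>Y. of_real (weight x) * f x) (mean f) < e)"
  proof (intro exI[of _ ?X] conjI allI impI)
    show "finite ?X" using vanish[of "e / 2"] e by simp
    fix Y assume Y: "finite Y \<and> ?X \<subseteq> Y \<and> Y \<subseteq> queue_states"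
    let ?in = "\<lambda>x. if x \<in> Y then f x else 0" and ?out = "\<lambda>x. if x \<in> Y then 0 else f x"
    have out: "norm (?out x) \<le> e / 2" if "x \<in> queue_states" for x
      using Y that e by (cases "x \<in> Y") (auto intro: leI)
    have tame_out: "tame ?out"
      by (rule tame_bounded) (rule out)
    have "mean f = mean (\<lambda>x. ?in x + ?out x)"
      by (rule mean_cong) simp
    also have "\<dots> = mean ?in + mean ?out"
      using Y by (intro mean_add tame_finite tame_out) simp
    finally have "mean f = mean ?in + mean ?out" .
    moreover have "norm (mean ?out) \<le> e / 2"
      by (rule norm_mean_le[OF out])
    ultimately show "dist (\<Sum>x\<in>Y. of_real (weight x) * f x) (mean f) < e"
      using mean_finite[of Y f] Y e by (simp add: dist_norm)
  qed auto
qed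

lemma weight_nonneg: "weight y \<ge> 0"
proof -
  have "(\<lambda>n. (jump ^^ n) (\<lambda>x. of_bool (x = y) :: real) (0, 0, 0)) \<longlonglongrightarrow> weight y"
    unfolding weight_def by (rule jump_iter_tendsto[OF tame_indicator empty_state])
  then show ?thesis
    by (rule tendsto_lowerbound) (simp_all add: jump_iter_nonneg)
qed

lemma weight_sum_le_1:
  assumes "finite F"
  shows "(\<Sum>y\<in>F. weight y) \<le> 1"
proof -
  have "norm (mean (\<lambda>x. if x \<in> F then 1 else 0 :: complex)) \<le> 1"
    by (rule norm_mean_le) auto
  then have "norm (complex_of_real (\<Sum>y\<in>F. weight y)) \<le> 1"
    unfolding mean_finite[OF assms] by simp
  then show ?thesis
    unfolding norm_of_real by simp
qed

lemma weight_summable: "weight summable_on A"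
proof (rule nonneg_bdd_above_summable_on)
  show "bdd_above (sum weight ` {F. F \<subseteq> A \<and> finite F})"
    using weight_sum_le_1 by (intro bdd_aboveI[of _ 1]) auto
qed (rule weight_nonneg)

end

section \<open>Balance equations for the generating functions\<close>

text \<open>
  The monomial \<open>z1 ^ i * z2 ^ j\<close> restricted to states where a customer of class \<open>c\<close> is served
  (\<open>c = 0\<close>: the server is free). At \<open>z1 = 0\<close> the convention \<open>0 ^ 0 = 1\<close> makes it select the states without
  class-1 customers.
\<close>

definition class_term :: "nat \<Rightarrow> complex \<Rightarrow> complex \<Rightarrow> state \<Rightarrow> complex" where
  "class_term c z1 z2 = (\<lambda>(i, j, k). if k = c then z1 ^ i * z2 ^ j else 0)"

lemma norm_class_term_le:
  assumes "norm z1 \<le> 1" "norm z2 \<le> 1"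
  shows "norm (class_term c z1 z2 x) \<le> 1"
proof (cases x)
  case (fields i j k)
  have "norm (z1 ^ i * z2 ^ j) \<le> 1 * 1"
    unfolding norm_mult norm_power using assms by (intro mult_mono power_le_one) auto
  then show ?thesis using fields by (simp add: class_term_def)
qed

lemma class_term_vanishes:
  assumes "norm z1 < 1" "norm z2 < 1" "e > 0"
  shows "finite {x \<in> queue_states. norm (class_term c z1 z2 x) > e}"
proof -
  define m where "m = max (norm z1) (norm z2)"
  have m: "0 \<le> m" "m < 1" "norm z1 \<le> m" "norm z2 \<le> m"
    using assms by (auto simp: m_def le_max_iff_disj)
  obtain N where N: "m ^ N < e"
    using real_arch_pow_inv[OF assms(3) m(2)] by blast
  have "i < N \<and> j < N \<and> k < 3" if "(i, j, k) \<in> queue_states" "norm (class_term c z1 z2 (i, j, k)) > e" for i j k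
  proof -
    have "norm (z1 ^ i * z2 ^ j) > e"
      using that(2) assms(3) by (auto simp: class_term_def split: if_splits)
    moreover have "norm (z1 ^ i * z2 ^ j) \<le> m ^ i * m ^ j"
      unfolding norm_mult norm_power using m by (intro mult_mono power_mono) auto
    ultimately have "m ^ N < m ^ (i + j)"
      using N by (simp add: power_add)
    then have "i + j < N"
      using m by (meson less_le_not_le not_less power_decreasing)
    then show ?thesis
      using that(1) by (auto simp: queue_states_iff)
  qed
  then have "{x \<in> queue_states. norm (class_term c z1 z2 x) > e} \<subseteq> {..<N} \<times> {..<N} \<times> {..<3}"
    by auto
  then show ?thesis
    by (rule finite_subset) simp
qed

context stable_queue
begin

text \<open>
  On average the headcount changes at rate \<open>l1 + l2 - mu\<close>, plus \<open>mu\<close> at the empty state where no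
  service takes place; in stationarity these changes cancel.
\<close>

lemma weight_empty: "weight (0, 0, 0) = (mu - l1 - l2) / mu"
proof -
  let ?N = "\<lambda>x. real (headcount x)" and ?I = "\<lambda>x::state. of_bool (x = (0, 0, 0)) :: real"
  have drift: "l1 *\<^sub>R ?N (arrive1 x) + l2 *\<^sub>R ?N (arrive2 x) + mu *\<^sub>R ?N (after_service x) =
      theta *\<^sub>R ?N x + ((l1 + l2 - mu) + mu *\<^sub>R ?I x)" if "x \<in> queue_states" for x
  proof (cases "x = (0, 0, 0)")
    case True
    then show ?thesis
      using that by (simp add: headcount_def arrive1_def arrive2_def after_service_def)
  next
    case False
    then have "headcount x \<ge> 1"
      using headcount_eq_0[OF that] by simp
    then have "real (headcount x - 1) = real (headcount x) - 1"
      by (simp add: of_nat_diff)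
    then show ?thesis
      using that False by (simp add: theta_def algebra_simps)
  qed
  have tI: "tame (\<lambda>x. mu *\<^sub>R ?I x)" and tN: "tame (\<lambda>x. theta *\<^sub>R ?N x)"
    by (rule tame_bounded_linear[OF bounded_linear_scaleR_right], rule tame_indicator tame_headcount)+
  have tc: "tame (\<lambda>x::state. l1 + l2 - mu)"
    by (rule tame_bounded) (rule order_refl)
  have "theta *\<^sub>R mean ?N = mean (\<lambda>x. theta *\<^sub>R ?N x + ((l1 + l2 - mu) + mu *\<^sub>R ?I x))"
    unfolding mean_rates[OF tame_headcount, symmetric] by (rule mean_cong) (rule drift)
  also have "\<dots> = theta *\<^sub>R mean ?N + ((l1 + l2 - mu) + mu *\<^sub>R weight (0, 0, 0))"
    unfolding weight_def mean_add[OF tN tame_add[OF tc tI]] mean_add[OF tc tI] mean_const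
      mean_scaleR[OF tame_headcount] mean_scaleR[OF tame_indicator] ..
  finally show ?thesis
    using mu by (simp add: field_simps)
qed

lemma tame_class_term: "norm z1 \<le> 1 \<Longrightarrow> norm z2 \<le> 1 \<Longrightarrow> tame (class_term c z1 z2)"
  by (rule tame_bounded) (rule norm_class_term_le)

lemma class_term_0:
  "x \<in> queue_states \<Longrightarrow> class_term 0 z1 z2 x = of_bool (x = (0, 0, 0))"
  by (cases x) (auto simp: queue_states_iff class_term_def)

lemma mean_class_0: "mean (class_term 0 z1 z2) = of_real (weight (0, 0, 0))"
  unfolding mean_indicator[symmetric] by (rule mean_cong) (simp add: class_term_0)

text \<open>
  Apart from the factor \<open>l1 * z1 + l2 * z2\<close> from arrivals, the transitions feed class-2 service only
  through \<open>g\<close>: a service completion that leaves no class-1 customer, or an arrival to the empty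
  system. Both occur at \<open>i = 0\<close>, so \<open>g\<close> does not involve \<open>z1\<close>, and comparing with \<open>z1 = 0\<close>
  eliminates it.
\<close>

lemma class2_balance:
  fixes z1 z2 :: complex
  assumes z: "norm z1 \<le> 1" "norm z2 \<le> 1"
  shows "(theta - l1 * z1 - l2 * z2) * mean (class_term 2 z1 z2) =
    (theta - l2 * z2) * mean (class_term 2 0 z2)"
proof -
  define g where "g x = mu * class_term 2 0 z2 (after_service x) + l2 * z2 * of_bool (x = (0, 0, 0))" for x
  have g: "tame g"
  proof (rule tame_bounded)
    fix x
    have "norm (g x) \<le> norm (mu * class_term 2 0 z2 (after_service x)) +
        norm (l2 * z2 * of_bool (x = (0, 0, 0)))"
      unfolding g_def by (rule norm_triangle_ineq)
    also have "\<dots> \<le> mu * 1 + l2 * 1"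
      using z l2 mu norm_class_term_le[of 0 z2 2 "after_service x"]
      by (intro add_mono) (auto simp: norm_mult)
    finally show "norm (g x) \<le> mu * 1 + l2 * 1" .
  qed
  have "(theta - l1 * w - l2 * z2) * mean (class_term 2 w z2) = mean g" if w: "norm w \<le> 1" for w :: complex
  proof -
    let ?f = "class_term 2 w z2"
    have t: "tame ?f" using w z(2) by (rule tame_class_term)
    have "l1 *\<^sub>R ?f (arrive1 x) + l2 *\<^sub>R ?f (arrive2 x) + mu *\<^sub>R ?f (after_service x) =
        (l1 * w + l2 * z2) * ?f x + g x" if "x \<in> queue_states" for x
      using that
      by (cases x) (auto simp: queue_states_iff g_def class_term_def arrive1_def arrive2_def
          after_service_def next_class_def scaleR_conv_of_real Suc_le_eq algebra_simps)
    then have "theta *\<^sub>R mean ?f = mean (\<lambda>x. (l1 * w + l2 * z2) * ?f x + g x)"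
      unfolding mean_rates[OF t, symmetric] by (rule mean_cong)
    also have "\<dots> = (l1 * w + l2 * z2) * mean ?f + mean g"
      unfolding mean_add[OF tame_mult[OF t] g] mean_mult[OF t] ..
    finally show ?thesis
      by (simp add: scaleR_conv_of_real algebra_simps)
  qed
  from this[OF z(1)] this[of 0] show ?thesis by simp
qed

text \<open>
  Summed over the classes in service, the class chosen next does not matter: arrivals multiply the monomial
  by \<open>z1\<close> or \<open>z2\<close>, and a service of class 1 or 2 divides it by \<open>z1\<close> or \<open>z2\<close>.
\<close>

lemma total_balance:
  fixes z1 z2 :: complex
  assumes z: "norm z1 \<le> 1" "norm z2 \<le> 1" and nz: "z1 \<noteq> 0" "z2 \<noteq> 0"
  shows "(l1 * (1 - z1) + l2 * (1 - z2)) *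
      (mean (class_term 1 z1 z2) + mean (class_term 2 z1 z2) + weight (0, 0, 0)) +
      mu * (1 - 1 / z1) * mean (class_term 1 z1 z2) + mu * (1 - 1 / z2) * mean (class_term 2 z1 z2) = 0"
proof -
  let ?f = "\<lambda>c. class_term c z1 z2" and ?l = "l1 * z1 + l2 * z2"
  let ?s = "\<lambda>x. ?f 1 x + (?f 2 x + ?f 0 x)"
  have t: "tame (?f c)" for c using z by (rule tame_class_term)
  have ts: "tame ?s" by (intro tame_add t)
  have "l1 *\<^sub>R ?s (arrive1 x) + l2 *\<^sub>R ?s (arrive2 x) + mu *\<^sub>R ?s (after_service x) =
      ?l * ?s x + (mu / z1 * ?f 1 x + (mu / z2 * ?f 2 x + mu * ?f 0 x))" if "x \<in> queue_states" for x
  proof -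
    obtain i j k where x: "x = (i, j, k)" by (cases x)
    \<comment> \<open>A service of class 1 (or 2) happens only when \<open>i \<ge> 1\<close> (or \<open>j \<ge> 1\<close>), so that the predecessor is genuine.\<close>
    have pred: "i \<ge> 1 \<Longrightarrow> z1 ^ i = z1 * z1 ^ (i - 1)" "j \<ge> 1 \<Longrightarrow> z2 ^ j = z2 * z2 ^ (j - 1)"
      by (simp_all flip: power_Suc)
    show ?thesis
      using that nz pred unfolding x
      by (auto simp: queue_states_iff class_term_def arrive1_def arrive2_def
          after_service_def next_class_def scaleR_conv_of_real algebra_simps)
  qed
  then have "theta *\<^sub>R mean ?s = mean (\<lambda>x. ?l * ?s x + (mu / z1 * ?f 1 x + (mu / z2 * ?f 2 x + mu * ?f 0 x)))"
    unfolding mean_rates[OF ts, symmetric] by (rule mean_cong)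
  also have "\<dots> = ?l * mean ?s + (mu / z1 * mean (?f 1) + (mu / z2 * mean (?f 2) + mu * mean (?f 0)))"
    by (simp only: mean_add mean_mult tame_add tame_mult t)
  finally show ?thesis
    unfolding mean_add[OF t tame_add[OF t t]] mean_add[OF t t] mean_class_0
    by (simp add: theta_def scaleR_conv_of_real algebra_simps)
qed

lemma class_has_sum:
  assumes z: "norm z1 < 1" "norm z2 < 1"
    and inj: "inj_on h A" and sub: "h ` A \<subseteq> queue_states"
    and zero: "\<And>x. x \<in> queue_states \<Longrightarrow> x \<notin> h ` A \<Longrightarrow> class_term c z1 z2 x = 0"
  shows "((\<lambda>a. of_real (weight (h a)) * class_term c z1 z2 (h a)) has_sum mean (class_term c z1 z2)) A"
proof -
  have "((\<lambda>x. of_real (weight x) * class_term c z1 z2 x) has_sum mean (class_term c z1 z2)) queue_states"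
    using z by (intro has_sum_mean class_term_vanishes tame_class_term) auto
  also have "?this \<longleftrightarrow> ((\<lambda>x. of_real (weight x) * class_term c z1 z2 x) has_sum mean (class_term c z1 z2)) (h ` A)"
    using sub zero by (intro has_sum_cong_neutral) auto
  finally show ?thesis
    unfolding has_sum_reindex[OF inj] by (simp add: o_def)
qed

context
  fixes p :: "nat \<Rightarrow> nat \<Rightarrow> nat \<Rightarrow> real"
  assumes p: "\<And>i j k. (i, j, k) \<in> queue_states \<Longrightarrow> p i j k = weight (i, j, k)"
begin

lemma pgf_class1_eq:
  assumes z: "norm z1 < 1" "norm z2 < 1"
  shows "pgf_class1 p z1 z2 = mean (class_term 1 z1 z2)"
  unfolding pgf_class1_def
proof (rule infsumI)
  have "((\<lambda>a. of_real (weight ((\<lambda>(i, j). (i, j, 1)) a)) * class_term 1 z1 z2 ((\<lambda>(i, j). (i, j, 1)) a))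
      has_sum mean (class_term 1 z1 z2)) ({1..} \<times> {0..})"
    by (rule class_has_sum[OF z])
      (auto simp: inj_on_def queue_states_iff class_term_def image_iff split: if_splits)
  then show "((\<lambda>(i, j). of_real (p i j 1) * z1 ^ i * z2 ^ j) has_sum mean (class_term 1 z1 z2)) ({1..} \<times> {0..})"
    by (rule has_sum_cong[THEN iffD1, rotated]) (auto simp: p queue_states_iff class_term_def)
qed

lemma pgf_class2_eq:
  assumes z: "norm z1 < 1" "norm z2 < 1"
  shows "pgf_class2 p z1 z2 = mean (class_term 2 z1 z2)"
  unfolding pgf_class2_def
proof (rule infsumI)
  have "((\<lambda>a. of_real (weight ((\<lambda>(i, j). (i, j, 2)) a)) * class_term 2 z1 z2 ((\<lambda>(i, j). (i, j, 2)) a))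
      has_sum mean (class_term 2 z1 z2)) ({0..} \<times> {1..})"
    by (rule class_has_sum[OF z])
      (auto simp: inj_on_def queue_states_iff class_term_def image_iff split: if_splits)
  then show "((\<lambda>(i, j). of_real (p i j 2) * z1 ^ i * z2 ^ j) has_sum mean (class_term 2 z1 z2)) ({0..} \<times> {1..})"
    by (rule has_sum_cong[THEN iffD1, rotated]) (auto simp: p queue_states_iff class_term_def)
qed

lemma pgf_class2_alone_eq:
  assumes z: "norm z2 < 1"
  shows "pgf_class2_alone p z2 = mean (class_term 2 0 z2)"
  unfolding pgf_class2_alone_def
proof (rule infsumI)
  have "((\<lambda>j. of_real (weight (0, j, 2)) * class_term 2 0 z2 (0, j, 2))
      has_sum mean (class_term 2 0 z2)) {1..}"
    by (rule class_has_sum[OF _ z])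
      (auto simp: inj_on_def queue_states_iff class_term_def image_iff split: if_splits)
  then show "((\<lambda>j. of_real (p 0 j 2) * z2 ^ j) has_sum mean (class_term 2 0 z2)) {1..}"
    by (rule has_sum_cong[THEN iffD1, rotated]) (auto simp: p queue_states_iff class_term_def)
qed

end

text \<open>
  On the closed bidisc the monomials do not vanish at infinity; the series are summable because
  the weights are.
\<close>

lemma joint_pgf_eq:
  assumes p: "\<And>i j k. p i j k = (if (i, j, k) \<in> queue_states then weight (i, j, k) else 0)"
    and q: "\<And>i j. q i j = p i j 0 + p i j 1 + p i j 2"
    and z: "norm z1 \<le> 1" "norm z2 \<le> 1"
  shows "joint_pgf q z1 z2 = pgf_class1 p z1 z2 + pgf_class2 p z1 z2 + p 0 0 0"
proof -
  define h where "h k = (\<lambda>(i, j). of_real (p i j k) * z1 ^ i * z2 ^ j)" for k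
  have h_summable: "h k summable_on UNIV" for k
  proof -
    have "weight summable_on (\<lambda>(i, j). (i, j, k)) ` UNIV"
      by (rule weight_summable)
    then have "(weight \<circ> (\<lambda>(i, j). (i, j, k))) summable_on UNIV"
      by (subst summable_on_reindex[symmetric]) (auto simp: inj_on_def)
    moreover have "norm (h k x) \<le> (weight \<circ> (\<lambda>(i, j). (i, j, k))) x" for x
    proof -
      obtain i j where x: "x = (i, j)" by (cases x)
      have "norm (z1 ^ i) * norm (z2 ^ j) \<le> 1 * 1"
        unfolding norm_power using z by (intro mult_mono power_le_one) auto
      then have "norm (p i j k) * (norm (z1 ^ i) * norm (z2 ^ j)) \<le> norm (p i j k) * 1"
        by (intro mult_left_mono) auto
      then show ?thesis
        using weight_nonneg[of "(i, j, k)"] by (auto simp: x h_def p norm_mult mult.assoc)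
    qed
    ultimately have "(\<lambda>x. norm (h k x)) summable_on UNIV"
      by (intro summable_on_comparison_test[of _ _ "\<lambda>x. norm (h k x)"]) auto
    then show ?thesis by (rule abs_summable_summable)
  qed
  have "joint_pgf q z1 z2 = infsum (\<lambda>x. (h 1 x + h 2 x) + h 0 x) UNIV"
    unfolding joint_pgf_def by (intro infsum_cong) (auto simp: h_def q algebra_simps)
  also have "\<dots> = infsum (h 1) UNIV + infsum (h 2) UNIV + infsum (h 0) UNIV"
    by (simp only: infsum_add summable_on_add h_summable)
  also have "infsum (h 1) UNIV = pgf_class1 p z1 z2"
    unfolding pgf_class1_def h_def
    by (rule infsum_cong_neutral) (auto simp: p queue_states_iff split: if_splits)
  also have "infsum (h 2) UNIV = pgf_class2 p z1 z2"
    unfolding pgf_class2_def h_def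
    by (rule infsum_cong_neutral) (auto simp: p queue_states_iff split: if_splits)
  also have "infsum (h 0) UNIV = infsum (h 0) {(0, 0)}"
    by (rule infsum_cong_neutral) (auto simp: h_def p queue_states_iff split: if_splits)
  also have "\<dots> = p 0 0 0"
    by (simp add: h_def)
  finally show ?thesis .
qed

section \<open>The root in the unit disc and the closed formulas\<close>

text \<open>
  The product \<open>mu / l1\<close> of the two roots and their sum \<open>b / l1\<close> satisfy
  \<open>1 + \<bar>u * v\<bar> < \<bar>u + v\<bar>\<close>, since \<open>Re b > l1 + mu\<close>. This forces
  \<open>(1 - \<bar>u\<bar>) * (1 - \<bar>v\<bar>) < 0\<close>, so exactly one root lies in the disc.
\<close>

lemma disc_root_unique:
  assumes z2: "norm z2 < 1"
  shows "\<exists>!z1. is_disc_root l1 l2 mu z2 z1"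
proof -
  define b where "b = l1 + l2 * (1 - z2) + mu"
  have "\<bar>Re z2\<bar> < 1" using abs_Re_le_cmod z2 by (rule le_less_trans)
  then have "Re b > l1 + mu"
    using l2 by (simp add: b_def)
  then have nb: "norm b > l1 + mu"
    using complex_Re_le_cmod by (rule less_le_trans)
  have far: "(norm u < 1 \<and> 1 < norm v) \<or> (norm v < 1 \<and> 1 < norm u)"
    if uv: "l1 * (u + v) = b" "l1 * (u * v) = mu" for u v :: complex
  proof -
    have "l1 * norm (u + v) = norm b" "l1 * (norm u * norm v) = mu"
      using arg_cong[OF uv(1), of norm] arg_cong[OF uv(2), of norm] l1 mu by (simp_all add: norm_mult)
    then have "l1 * (1 + norm u * norm v) < l1 * norm (u + v)"
      using nb by (simp add: algebra_simps)
    also have "\<dots> \<le> l1 * (norm u + norm v)"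
      using l1 by (simp add: norm_triangle_ineq)
    finally have "1 + norm u * norm v < norm u + norm v"
      using l1 by simp
    then have "(1 - norm u) * (1 - norm v) < 0"
      by (simp add: algebra_simps)
    then show ?thesis
      by (auto simp: mult_less_0_iff)
  qed
  define s where "s = csqrt (b ^ 2 - 4 * l1 * mu)"
  define u v where "u = (b + s) / (2 * l1)" and "v = (b - s) / (2 * l1)"
  have sum: "l1 * (u + v) = b"
    using l1 by (simp add: u_def v_def field_simps)
  have "s ^ 2 = b ^ 2 - 4 * l1 * mu" by (simp add: s_def)
  then have "(b + s) * (b - s) = 4 * l1 * mu"
    by (simp add: power2_eq_square algebra_simps)
  then have prod: "l1 * (u * v) = mu"
    using l1 by (simp add: u_def v_def)
  have root: "is_disc_root l1 l2 mu z2 z \<longleftrightarrow> norm z < 1 \<and> (z = u \<or> z = v)" for z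
  proof -
    have "l1 * z ^ 2 - b * z + mu = l1 * ((z - u) * (z - v))"
      unfolding sum[symmetric] prod[symmetric] by (simp add: algebra_simps power2_eq_square)
    then show ?thesis
      using l1 by (simp add: is_disc_root_def b_def)
  qed
  show ?thesis
    unfolding root using far[OF sum prod] by fastforce
qed

lemma disc_root:
  assumes "norm z2 < 1"
  shows "is_disc_root l1 l2 mu z2 (disc_root l1 l2 mu z2)"
  unfolding disc_root_def by (rule theI'[OF disc_root_unique[OF assms]])

text \<open>
  At \<open>z1 = z2\<close> the quadratic factors as \<open>(z2 - 1) * ((l1 + l2) * z2 - mu)\<close>, and both of its roots
  lie outside the open disc. This keeps the denominator \<open>mu / z2 - mu / f\<close> of the first formula
  away from zero.
\<close>

lemma disc_root_neq:
  assumes "norm z2 < 1"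
  shows "\<not> is_disc_root l1 l2 mu z2 z2"
proof
  assume "is_disc_root l1 l2 mu z2 z2"
  then have "(z2 - 1) * ((l1 + l2) * z2 - mu) = 0"
    by (simp add: is_disc_root_def algebra_simps power2_eq_square)
  moreover have "z2 \<noteq> 1" using assms by auto
  ultimately have "(l1 + l2) * z2 = mu" by simp
  then have "norm (complex_of_real (l1 + l2) * z2) = norm (complex_of_real mu)" by simp
  then have "(l1 + l2) * norm z2 = mu"
    using l1 l2 mu unfolding norm_mult norm_of_real by simp
  moreover have "(l1 + l2) * norm z2 \<le> (l1 + l2) * 1"
    using l1 l2 assms by (intro mult_left_mono) auto
  ultimately show False using stable by simp
qed

lemma rate_nonzero:
  fixes z1 z2 :: complex
  assumes "norm z1 < 1" "norm z2 < 1"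
  shows "l1 * (1 - z1) + l2 * (1 - z2) + mu \<noteq> (0::complex)"
proof -
  have "Re z1 < 1" "Re z2 < 1"
    using assms by (meson complex_Re_le_cmod le_less_trans)+
  then have "Re (l1 * (1 - z1) + l2 * (1 - z2) + mu) > 0"
    using l1 l2 mu by (simp add: add_pos_pos)
  then show ?thesis by force
qed

text \<open>
  The kernel \<open>s w + mu * (1 - 1 / w)\<close> multiplying the class-1 mean is, up to the factor \<open>- 1 / w\<close>, the
  quadratic defining the disc root. Away from the root one divides by it; at \<open>w = f\<close> it vanishes
  and the rest of the equation determines \<open>G0\<close>.
\<close>

lemma generating_functions:
  fixes z1 z2 f W G0 :: complex
  assumes z: "norm z1 < 1" "norm z2 < 1" "z1 \<noteq> 0" "z2 \<noteq> 0" and ne: "z1 \<noteq> disc_root l1 l2 mu z2"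
    and f_def: "f = disc_root l1 l2 mu z2" and W_def: "W = weight (0, 0, 0)"
    and G0_def: "G0 = mean (class_term 2 0 z2)"
  shows "G0 = (l1 * (1 - f) + l2 * (1 - z2) + mu) * (l1 * (1 - f) + l2 * (1 - z2)) /
           ((mu / z2 - (l1 * (1 - f) + l2 * (1 - z2) + mu)) * (l1 + l2 * (1 - z2) + mu)) * W"
      (is ?alone)
    and "mean (class_term 2 z1 z2) =
           (l1 + l2 * (1 - z2) + mu) * G0 / (l1 * (1 - z1) + l2 * (1 - z2) + mu)" (is ?class2)
    and "mean (class_term 1 z1 z2) =
           ((l1 + l2 * (1 - z2) + mu) *
              (mu / z2 * (1 / (l1 * (1 - z1) + l2 * (1 - z2) + mu)) - 1) * G0 -
            (l1 * (1 - z1) + l2 * (1 - z2)) * W) /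
           (l1 * (1 - z1) + l2 * (1 - z2) + mu * (1 - 1 / z1))" (is ?class1)
proof -
  define H where "H = l1 + l2 * (1 - z2) + mu"
  define s where "s w = l1 * (1 - w) + l2 * (1 - z2)" for w :: complex
  have H: "H \<noteq> 0"
    using rate_nonzero[of 0 z2] z by (simp add: H_def)
  have class2: "mean (class_term 2 w z2) = H * G0 / (s w + mu)" if "norm w < 1" for w :: complex
  proof -
    have "(s w + mu) * mean (class_term 2 w z2) = H * G0"
      using class2_balance[of w z2] that z
      by (simp add: G0_def H_def s_def theta_def algebra_simps)
    moreover have "s w + mu \<noteq> 0"
      using rate_nonzero[OF that z(2)] by (simp add: s_def)
    ultimately show ?thesis by (simp add: field_simps)
  qed
  then show ?class2 using z by (simp add: H_def s_def)
  have class1: "(s w + mu * (1 - 1 / w)) * mean (class_term 1 w z2) =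
      H * (mu / z2 * (1 / (s w + mu)) - 1) * G0 - s w * W" if w: "norm w < 1" "w \<noteq> 0" for w :: complex
  proof -
    have nz: "s w + mu \<noteq> 0"
      using rate_nonzero[OF w(1) z(2)] by (simp add: s_def)
    have "(s w + mu * (1 - 1 / w)) * mean (class_term 1 w z2) =
        (mu / z2 - (s w + mu)) * mean (class_term 2 w z2) - s w * W"
      using total_balance[of w z2] w z by (simp add: s_def W_def algebra_simps)
    also have "(mu / z2 - (s w + mu)) * mean (class_term 2 w z2) = H * (mu / z2 * (1 / (s w + mu)) - 1) * G0"
      unfolding class2[OF w(1)] using nz z(4) by (simp add: divide_simps)
    finally show ?thesis .
  qed
  have root: "norm f < 1" "f * (s f + mu) = mu"
    using disc_root[OF z(2)] by (auto simp: f_def is_disc_root_def s_def power2_eq_square algebra_simps)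
  have f0: "f \<noteq> 0" using root mu by auto
  have sf: "s f + mu = mu / f" using root f0 by (simp add: field_simps)
  have "s z1 + mu * (1 - 1 / z1) \<noteq> 0"
  proof
    assume "s z1 + mu * (1 - 1 / z1) = 0"
    then have "z1 * (s z1 + mu) = mu" using z(3) by (simp add: field_simps)
    then have "is_disc_root l1 l2 mu z2 z1"
      using z(1) by (simp add: is_disc_root_def s_def power2_eq_square algebra_simps)
    then show False
      using ne disc_root[OF z(2)] disc_root_unique[OF z(2)] by blast
  qed
  then show ?class1
    using class1[OF z(1,3)] by (simp add: H_def s_def field_simps)
  have "f \<noteq> z2"
    using disc_root[OF z(2)] disc_root_neq[OF z(2)] by (auto simp: f_def)
  then have d: "mu / z2 - (s f + mu) \<noteq> 0"
    unfolding sf using f0 z(4) mu by (simp add: field_simps)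
  have "s f + mu * (1 - 1 / f) = 0"
    using sf by (simp add: algebra_simps)
  then have zero: "H * (mu / z2 * (1 / (s f + mu)) - 1) * G0 = s f * W"
    using class1[OF root(1) f0] by simp
  have cancel: "(mu / z2 * (1 / (s f + mu)) - 1) * (s f + mu) = mu / z2 - (s f + mu)"
  proof -
    have "(a * (1 / t) - 1) * t = a - t" if "t \<noteq> 0" for a t :: complex
      using that by (simp add: left_diff_distrib)
    moreover have "s f + mu \<noteq> 0" using sf f0 mu by simp
    ultimately show ?thesis .
  qed
  have "H * (mu / z2 - (s f + mu)) * G0 = (s f + mu) * (H * (mu / z2 * (1 / (s f + mu)) - 1) * G0)"
    unfolding cancel[symmetric] by (simp only: mult_ac)
  then have "H * (mu / z2 - (s f + mu)) * G0 = (s f + mu) * s f * W"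
    unfolding zero by (simp only: mult.assoc)
  then have "G0 = (s f + mu) * s f / ((mu / z2 - (s f + mu)) * H) * W"
    using H d by (simp add: nonzero_eq_divide_eq mult_ac)
  then show ?alone by (simp add: H_def s_def)
qed

section \<open>Uniformization of the transition function\<close>

abbreviation rate :: "state \<Rightarrow> state \<Rightarrow> real" where
  "rate \<equiv> queue_rate l1 l2 mu"

definition reach :: "state \<Rightarrow> state set" where
  "reach x = {x, arrive1 x, arrive2 x, after_service x}"

lemma finite_reach [simp]: "finite (reach x)"
  by (simp add: reach_def)

lemma in_reach [simp]: "x \<in> reach x"
  by (simp add: reach_def)

lemma reach_subset: "x \<in> queue_states \<Longrightarrow> reach x \<subseteq> queue_states"
  by (simp add: reach_def)

text \<open>
  Off the diagonal only: at the empty state the completion map fixes the state, and that fictitious transition must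
  not be counted.
\<close>

lemma rate_eq:
  assumes "x \<in> queue_states" "y \<noteq> x"
  shows "rate x y = l1 * of_bool (y = arrive1 x) + l2 * of_bool (y = arrive2 x) +
    mu * of_bool (y = after_service x)"
proof -
  obtain i j k where ijk: "x = (i, j, k)"
    by (cases x)
  show ?thesis
  proof (cases "k = 0")
    case True
    then have "x = (0, 0, 0)"
      using assms(1) by (simp add: ijk queue_states_iff)
    then show ?thesis
      using assms(2) by (simp add: queue_rate_def arrive1_def arrive2_def after_service_def next_class_def)
  next
    case False
    have arrive: "arrive1 x = (i + 1, j, k)" "arrive2 x = (i, j + 1, k)"
      using False by (simp_all add: ijk arrive1_def arrive2_def)
    moreover have "arrive1 x \<noteq> arrive2 x" "arrive1 x \<noteq> after_service x" "arrive2 x \<noteq> after_service x"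
    proof -
      have "Suc n \<noteq> n - Suc 0" for n by simp
      then show "arrive1 x \<noteq> arrive2 x" "arrive1 x \<noteq> after_service x" "arrive2 x \<noteq> after_service x"
        unfolding arrive by (simp_all add: ijk after_service_def)
    qed
    moreover have "rate x y = (if y = (i + 1, j, k) then l1 else if y = (i, j + 1, k) then l2
        else if y = after_service x then mu else 0)"
      using False by (simp add: ijk queue_rate_def)
    ultimately show ?thesis by simp
  qed
qed

lemma generator_sum:
  assumes x: "x \<in> queue_states"
  shows "(\<Sum>y\<in>reach x. generator queue_states rate x y * f y) = theta * (jump f x - f x)"
proof -
  have diag: "generator queue_states rate x x = - (\<Sum>y\<in>reach x - {x}. rate x y)"
  proof -
    have "(\<Sum>\<^sub>\<infinity>y\<in>queue_states - {x}. rate x y) = (\<Sum>\<^sub>\<infinity>y\<in>reach x - {x}. rate x y)"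
    proof (rule infsum_cong_neutral)
      fix y assume "y \<in> (queue_states - {x}) - (reach x - {x})"
      then show "rate x y = 0"
        using rate_eq[OF x, of y] by (auto simp: reach_def)
    qed (use reach_subset[OF x] in auto)
    then show ?thesis by (simp add: generator_def)
  qed
  have "(\<Sum>y\<in>reach x. generator queue_states rate x y * f y) =
      generator queue_states rate x x * f x + (\<Sum>y\<in>reach x - {x}. rate x y * f y)"
  proof -
    have "(\<Sum>y\<in>reach x - {x}. generator queue_states rate x y * f y) = (\<Sum>y\<in>reach x - {x}. rate x y * f y)"
    proof (rule sum.cong[OF refl])
      fix y assume "y \<in> reach x - {x}"
      then have "x \<noteq> y" by auto
      then show "generator queue_states rate x y * f y = rate x y * f y"
        by (simp add: generator_def)
    qed
    then show ?thesis
      by (simp add: sum.remove[of _ x])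
  qed
  also have "\<dots> = (\<Sum>y\<in>reach x - {x}. rate x y * (f y - f x))"
    unfolding diag right_diff_distrib sum_subtractf by (simp add: sum_distrib_right)
  also have "\<dots> = (\<Sum>y\<in>reach x - {x}. (l1 * of_bool (y = arrive1 x) + l2 * of_bool (y = arrive2 x) +
      mu * of_bool (y = after_service x)) * (f y - f x))"
    by (intro sum.cong refl) (simp add: rate_eq[OF x])
  also have "\<dots> = (\<Sum>y\<in>reach x. (l1 * of_bool (y = arrive1 x) + l2 * of_bool (y = arrive2 x) +
      mu * of_bool (y = after_service x)) * (f y - f x))"
    by (intro sum.mono_neutral_left) auto
  also have "\<dots> = (\<Sum>y\<in>reach x. if y = arrive1 x then l1 * (f y - f x) else 0) +
      (\<Sum>y\<in>reach x. if y = arrive2 x then l2 * (f y - f x) else 0) +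
      (\<Sum>y\<in>reach x. if y = after_service x then mu * (f y - f x) else 0)"
    unfolding sum.distrib[symmetric] by (intro sum.cong refl) (simp add: algebra_simps)
  also have "\<dots> = l1 * (f (arrive1 x) - f x) + l2 * (f (arrive2 x) - f x) + mu * (f (after_service x) - f x)"
    by (simp add: reach_def)
  also have "\<dots> = theta * (jump f x - f x)"
  proof -
    have "theta * jump f x = l1 * f (arrive1 x) + l2 * f (arrive2 x) + mu * f (after_service x)"
      using theta_pos by (simp add: jump_def)
    then show ?thesis
      by (simp add: right_diff_distrib theta_def distrib_right)
  qed
  finally show ?thesis .
qed

context
  fixes P :: "real \<Rightarrow> state \<Rightarrow> state \<Rightarrow> real"
  assumes tf: "transition_function queue_states P"
    and rates: "has_transition_rates queue_states rate P"
begin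

lemma P_nonneg: "t \<ge> 0 \<Longrightarrow> x \<in> queue_states \<Longrightarrow> y \<in> queue_states \<Longrightarrow> P t x y \<ge> 0"
  using tf by (simp add: transition_function_def)

lemma P_has_sum: "t \<ge> 0 \<Longrightarrow> x \<in> queue_states \<Longrightarrow> (P t x has_sum 1) queue_states"
  using tf by (simp add: transition_function_def)

lemma P_0: "x \<in> queue_states \<Longrightarrow> y \<in> queue_states \<Longrightarrow> P 0 x y = of_bool (x = y)"
  using tf by (simp add: transition_function_def)

lemma P_compose:
  "s \<ge> 0 \<Longrightarrow> t \<ge> 0 \<Longrightarrow> x \<in> queue_states \<Longrightarrow> y \<in> queue_states \<Longrightarrow>
    ((\<lambda>z. P s x z * P t z y) has_sum P (s + t) x y) queue_states"
  using tf by (simp add: transition_function_def)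

lemma P_sum_le_1:
  assumes "t \<ge> 0" "x \<in> queue_states" "finite F" "F \<subseteq> queue_states"
  shows "(\<Sum>y\<in>F. P t x y) \<le> 1"
  by (rule has_sum_mono2[OF has_sum_finite[OF assms(3)] P_has_sum[OF assms(1,2)] assms(4)])
    (use assms P_nonneg in auto)

lemma P_le_1: "t \<ge> 0 \<Longrightarrow> x \<in> queue_states \<Longrightarrow> y \<in> queue_states \<Longrightarrow> P t x y \<le> 1"
  using P_sum_le_1[of t x "{y}"] by simp

text \<open>
  \<open>escape x h\<close> is the probability of being, at time \<open>h\<close>, outside the finite set of states reachable
  in at most one transition. As the generator has row sums zero, it is \<open>o(h)\<close>, which allows the
  pointwise derivatives of the transition function at \<open>0\<close> to be summed over the target state.
  \<open>modulus x\<close> is then a modulus of continuity of \<open>P\<close> in time.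
\<close>

definition escape :: "state \<Rightarrow> real \<Rightarrow> real" where
  "escape x h = 1 - (\<Sum>y\<in>reach x. P h x y)"

definition modulus :: "state \<Rightarrow> real \<Rightarrow> real" where
  "modulus x h = (\<Sum>z\<in>reach x. \<bar>P h x z - of_bool (x = z)\<bar>) + escape x h"

lemma quotient_tendsto:
  "x \<in> queue_states \<Longrightarrow> y \<in> queue_states \<Longrightarrow>
    ((\<lambda>h. (P h x y - of_bool (x = y)) / h) \<longlongrightarrow> generator queue_states rate x y) (at_right 0)"
  using rates by (simp add: has_transition_rates_def)

lemma escape_tendsto:
  assumes x: "x \<in> queue_states"
  shows "((\<lambda>h. escape x h / h) \<longlongrightarrow> 0) (at_right 0)"
proof -
  have "((\<lambda>h. - (\<Sum>y\<in>reach x. (P h x y - of_bool (x = y)) / h)) \<longlongrightarrow>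
      - (\<Sum>y\<in>reach x. generator queue_states rate x y)) (at_right 0)"
    using reach_subset[OF x] x by (intro tendsto_minus tendsto_sum quotient_tendsto) auto
  moreover have "(\<Sum>y\<in>reach x. generator queue_states rate x y) = 0"
    using generator_sum[OF x, of "\<lambda>_. 1"] by simp
  moreover have "- (\<Sum>y\<in>reach x. (P h x y - of_bool (x = y)) / h) = escape x h / h" for h
    by (simp add: escape_def sum_subtractf minus_divide_left flip: sum_divide_distrib)
  ultimately show ?thesis by simp
qed

lemma modulus_tendsto:
  assumes x: "x \<in> queue_states"
  shows "(modulus x \<longlongrightarrow> 0) (at_right 0)"
proof -
  have "((\<lambda>h. (\<Sum>z\<in>reach x. \<bar>h * ((P h x z - of_bool (x = z)) / h)\<bar>) + h * (escape x h / h)) \<longlongrightarrow>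
     (\<Sum>z\<in>reach x. \<bar>0 * generator queue_states rate x z\<bar>) + 0 * 0) (at_right 0)"
    using reach_subset[OF x] x
    by (intro tendsto_add tendsto_mult tendsto_sum tendsto_rabs quotient_tendsto escape_tendsto tendsto_ident_at) auto
  then have "((\<lambda>h. (\<Sum>z\<in>reach x. \<bar>h * ((P h x z - of_bool (x = z)) / h)\<bar>) + h * (escape x h / h)) \<longlongrightarrow> 0)
      (at_right 0)" by simp
  then show ?thesis
  proof (rule Lim_transform_eventually)
    show "\<forall>\<^sub>F h in at_right 0. (\<Sum>z\<in>reach x. \<bar>h * ((P h x z - of_bool (x = z)) / h)\<bar>) +
        h * (escape x h / h) = modulus x h"
      using eventually_at_right_less[of "0::real"] by eventually_elim (simp add: modulus_def)
  qed
qed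

lemma increment:
  assumes h: "h \<ge> 0" and t: "t \<ge> 0" and x: "x \<in> queue_states" and y: "y \<in> queue_states"
  shows "\<bar>P (h + t) x y - P t x y - (\<Sum>z\<in>reach x. (P h x z - of_bool (x = z)) * P t z y)\<bar> \<le> escape x h"
proof -
  let ?d = "P (h + t) x y - (\<Sum>z\<in>reach x. P h x z * P t z y)"
  have d: "((\<lambda>z. P h x z * P t z y) has_sum ?d) (queue_states - reach x)"
    by (rule has_sum_Diff[OF P_compose[OF h t x y] has_sum_finite[OF finite_reach] reach_subset[OF x]])
  have e: "(P h x has_sum escape x h) (queue_states - reach x)"
    unfolding escape_def
    by (rule has_sum_Diff[OF P_has_sum[OF h x] has_sum_finite[OF finite_reach] reach_subset[OF x]])
  have "?d \<ge> 0"
    using h t x y by (intro has_sum_nonneg[OF d] mult_nonneg_nonneg P_nonneg) auto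
  moreover have "?d \<le> escape x h"
    using h t x y by (intro has_sum_mono[OF d e] mult_left_le P_le_1 P_nonneg) auto
  moreover have "(\<Sum>z\<in>reach x. of_bool (x = z) * P t z y) = P t x y"
    by (simp add: of_bool_def if_distrib[of "\<lambda>c. c * _"] cong: if_cong)
  ultimately show ?thesis
    by (simp add: left_diff_distrib sum_subtractf)
qed

lemma increment_le_modulus:
  assumes h: "h \<ge> 0" and t: "t \<ge> 0" and x: "x \<in> queue_states" and y: "y \<in> queue_states"
  shows "\<bar>P (h + t) x y - P t x y\<bar> \<le> modulus x h"
proof -
  have "\<bar>\<Sum>z\<in>reach x. (P h x z - of_bool (x = z)) * P t z y\<bar> \<le>
      (\<Sum>z\<in>reach x. \<bar>(P h x z - of_bool (x = z)) * P t z y\<bar>)"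
    by (rule sum_abs)
  also have "\<dots> \<le> (\<Sum>z\<in>reach x. \<bar>P h x z - of_bool (x = z)\<bar>)"
  proof (rule sum_mono)
    fix z assume "z \<in> reach x"
    then have "z \<in> queue_states" using reach_subset[OF x] by auto
    then show "\<bar>(P h x z - of_bool (x = z)) * P t z y\<bar> \<le> \<bar>P h x z - of_bool (x = z)\<bar>"
      using P_nonneg[OF t _ y, of z] P_le_1[OF t _ y, of z] by (simp add: abs_mult mult_left_le)
  qed
  finally show ?thesis
    using increment[OF assms] by (simp add: modulus_def)
qed

text \<open>
  The left and the right difference quotients at \<open>t\<close> are handled together: with
  \<open>h = \<bar>s - t\<bar>\<close>, both are increments over a time \<open>h\<close> from the earlier time \<open>min s t\<close>. Conditioning on the
  first \<open>h\<close> units of time gives a finite sum with an error of at most \<open>escape x h / h\<close>.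
\<close>

lemma P_backward:
  assumes t: "t \<ge> 0" and x: "x \<in> queue_states" and y: "y \<in> queue_states"
  shows "((\<lambda>t. P t x y) has_field_derivative theta * (jump (\<lambda>z. P t z y) x - P t x y)) (at t within {0..})"
  unfolding has_field_derivative_iff
proof (rule Lim_transform)
  let ?h = "\<lambda>s. \<bar>s - t\<bar>"
  let ?F = "at t within {0..}"
  have h: "filterlim ?h (at_right 0) ?F"
    unfolding filterlim_at
  proof
    show "\<forall>\<^sub>F s in ?F. ?h s \<in> {0<..} \<and> ?h s \<noteq> 0"
      by (auto simp: eventually_at_filter)
    show "(?h \<longlongrightarrow> 0) ?F"
      by (rule tendsto_eq_intros refl)+ simp
  qed
  have base: "((\<lambda>s. P (min s t) z y) \<longlongrightarrow> P t z y) ?F" if z: "z \<in> queue_states" for z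
  proof -
    have "\<forall>\<^sub>F s in ?F. norm (P (min s t) z y - P t z y) \<le> modulus z (?h s)"
    proof (subst eventually_at_filter, rule always_eventually, intro allI impI)
      fix s :: real assume s: "s \<in> {0..}"
      show "norm (P (min s t) z y - P t z y) \<le> modulus z (?h s)"
      proof (cases "s \<le> t")
        case True
        then show ?thesis
          using increment_le_modulus[of "t - s" s z y] s z y by (simp add: min_def abs_minus_commute)
      next
        case False
        then show ?thesis
          using increment_le_modulus[of "s - t" t z y] t z y by (simp add: min_def)
      qed
    qed
    then have "((\<lambda>s. P (min s t) z y - P t z y) \<longlongrightarrow> 0) ?F"
      by (rule Lim_null_comparison) (rule filterlim_compose[OF modulus_tendsto[OF z] h])
    then show ?thesis by (simp add: LIM_zero_iff)
  qed
  have "((\<lambda>s. \<Sum>z\<in>reach x. (P (?h s) x z - of_bool (x = z)) / ?h s * P (min s t) z y) \<longlongrightarrow>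
      (\<Sum>z\<in>reach x. generator queue_states rate x z * P t z y)) ?F"
    using reach_subset[OF x]
    by (intro tendsto_sum tendsto_mult base filterlim_compose[OF quotient_tendsto[OF x] h]) auto
  then show "((\<lambda>s. \<Sum>z\<in>reach x. (P (?h s) x z - of_bool (x = z)) / ?h s * P (min s t) z y) \<longlongrightarrow>
      theta * (jump (\<lambda>z. P t z y) x - P t x y)) ?F"
    by (simp only: generator_sum[OF x])
  have "\<forall>\<^sub>F s in ?F. norm ((P s x y - P t x y) / (s - t) -
      (\<Sum>z\<in>reach x. (P (?h s) x z - of_bool (x = z)) / ?h s * P (min s t) z y)) \<le> escape x (?h s) / ?h s"
  proof (subst eventually_at_filter, rule always_eventually, intro allI impI)
    fix s :: real assume ne: "s \<noteq> t" and s: "s \<in> {0..}"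
    let ?S = "\<Sum>z\<in>reach x. (P (?h s) x z - of_bool (x = z)) * P (min s t) z y"
    let ?D = "P (?h s + min s t) x y - P (min s t) x y"
    have hp: "?h s > 0" using ne by simp
    have "(P s x y - P t x y) / (s - t) = ?D / ?h s"
      by (cases "s \<le> t") (simp_all add: min_def abs_if divide_simps ne algebra_simps)
    moreover have "(\<Sum>z\<in>reach x. (P (?h s) x z - of_bool (x = z)) / ?h s * P (min s t) z y) = ?S / ?h s"
      by (simp add: sum_divide_distrib)
    moreover have "\<bar>?D - ?S\<bar> \<le> escape x (?h s)"
      using s t x y by (intro increment) auto
    ultimately show "norm ((P s x y - P t x y) / (s - t) -
      (\<Sum>z\<in>reach x. (P (?h s) x z - of_bool (x = z)) / ?h s * P (min s t) z y)) \<le> escape x (?h s) / ?h s"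
      using hp by (simp add: diff_divide_distrib[symmetric] abs_divide divide_right_mono)
  qed
  then show "((\<lambda>s. (P s x y - P t x y) / (s - t) -
      (\<Sum>z\<in>reach x. (P (?h s) x z - of_bool (x = z)) / ?h s * P (min s t) z y)) \<longlongrightarrow> 0) ?F"
    by (rule Lim_null_comparison) (rule filterlim_compose[OF escape_tendsto[OF x] h])
qed

lemma P_jump_derivative:
  assumes t: "t \<ge> 0" and x: "x \<in> queue_states" and y: "y \<in> queue_states"
  shows "((\<lambda>t. (jump ^^ n) (\<lambda>z. P t z y) x) has_field_derivative
     theta * ((jump ^^ Suc n) (\<lambda>z. P t z y) x - (jump ^^ n) (\<lambda>z. P t z y) x)) (at t within {0..})"
  using x
proof (induction n arbitrary: x)
  case 0
  then show ?case using P_backward[OF t _ y] by simp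
next
  case (Suc n)
  let ?D = "\<lambda>x. theta * ((jump ^^ Suc n) (\<lambda>z. P t z y) x - (jump ^^ n) (\<lambda>z. P t z y) x)"
  have "((\<lambda>t. jump ((jump ^^ n) (\<lambda>z. P t z y)) x) has_field_derivative jump ?D x) (at t within {0..})"
    unfolding jump_def[of _ x] real_scaleR_def
    using Suc by (intro DERIV_cmult DERIV_add Suc.IH step_in_states)
  moreover have "jump ?D x = theta * ((jump ^^ Suc (Suc n)) (\<lambda>z. P t z y) x - (jump ^^ Suc n) (\<lambda>z. P t z y) x)"
    by (simp add: jump_def[of _ x] algebra_simps)
  ultimately show ?case by simp
qed

text \<open>
  By the backward equation the functions
  \<open>g n s = exp (theta * s) * theta ^ n * (jump ^^ n) (\<lambda>z. P s z y) x\<close> are the successive derivatives of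
  \<open>exp (theta * s) * P s x y\<close>. They are at most \<open>exp (theta * t) * theta ^ n\<close> on \<open>{0..t}\<close>, so the Taylor
  series at \<open>0\<close> converges to the function.
\<close>

lemma uniformization:
  assumes t: "t \<ge> 0" and x: "x \<in> queue_states" and y: "y \<in> queue_states"
  shows "(\<lambda>n. (jump ^^ n) (\<lambda>z. of_bool (z = y)) x * (theta * t) ^ n / fact n) sums (exp (theta * t) * P t x y)"
proof -
  define g where "g n s = exp (theta * s) * theta ^ n * (jump ^^ n) (\<lambda>z. P s z y) x" for n s
  have g_deriv: "(g n has_field_derivative g (Suc n) s) (at s within {0..t})" if "s \<in> {0..t}" for n s
  proof -
    let ?J = "\<lambda>n s. (jump ^^ n) (\<lambda>z. P s z y) x"
    have J: "(?J n has_field_derivative theta * (?J (Suc n) s - ?J n s)) (at s within {0..t})"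
      using that by (intro DERIV_subset[OF P_jump_derivative[OF _ x y]]) auto
    have E: "((\<lambda>s. exp (theta * s) * theta ^ n) has_field_derivative
        theta * (exp (theta * s) * theta ^ n)) (at s within {0..t})"
      by (auto intro!: derivative_eq_intros)
    have "((\<lambda>s. (exp (theta * s) * theta ^ n) * ?J n s) has_field_derivative
        theta * (exp (theta * s) * theta ^ n) * ?J n s +
        theta * (?J (Suc n) s - ?J n s) * (exp (theta * s) * theta ^ n)) (at s within {0..t})"
      by (rule DERIV_mult[OF E J])
    then show ?thesis
      by (simp add: g_def[abs_def] algebra_simps)
  qed
  have g_bound: "norm (g n s) \<le> exp (theta * t) * theta ^ n" if "s \<in> {0..t}" for n s
  proof -
    have "norm ((jump ^^ n) (\<lambda>z. P s z y) x) \<le> 1"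
      using that y P_nonneg P_le_1 by (intro norm_jump_iter_le[OF _ x]) auto
    moreover have "exp (theta * s) * theta ^ n \<le> exp (theta * t) * theta ^ n"
      using that theta_pos by simp
    ultimately have "exp (theta * s) * theta ^ n * norm ((jump ^^ n) (\<lambda>z. P s z y) x) \<le>
        exp (theta * t) * theta ^ n * 1"
      using theta_pos by (intro mult_mono) auto
    then show ?thesis
      using theta_pos by (simp add: g_def abs_mult)
  qed
  have g0: "g n 0 * t ^ n / fact n = (jump ^^ n) (\<lambda>z. of_bool (z = y)) x * (theta * t) ^ n / fact n" for n
    using jump_iter_cong[of "\<lambda>z. P 0 z y" "\<lambda>z. of_bool (z = y)" x n] x y
    by (simp add: g_def P_0 power_mult_distrib)
  have bound: "norm (exp (theta * t) * P t x y -
      (\<Sum>i\<le>n. (jump ^^ i) (\<lambda>z. of_bool (z = y)) x * (theta * t) ^ i / fact i)) \<le>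
      exp (theta * t) * (theta * t) * ((theta * t) ^ n /\<^sub>R fact n)" for n
  proof -
    have "norm (g 0 t - (\<Sum>i\<le>n. g i 0 * (t - 0) ^ i / fact i)) \<le>
        exp (theta * t) * theta ^ Suc n * norm (t - 0) ^ Suc n / fact n"
    proof (rule field_Taylor)
      show "convex {0..t}" by simp
      show "(g i has_field_derivative g (Suc i) s) (at s within {0..t})" if "s \<in> {0..t}" for i s
        using that by (rule g_deriv)
      show "norm (g (Suc n) s) \<le> exp (theta * t) * theta ^ Suc n" if "s \<in> {0..t}" for s
        using that by (rule g_bound)
    qed (use t in auto)
    then show ?thesis
      using t unfolding g_def[of 0] diff_zero g0 by (simp add: power_mult_distrib field_simps)
  qed
  have "(\<lambda>n. exp (theta * t) * (theta * t) * ((theta * t) ^ n /\<^sub>R fact n)) \<longlonglongrightarrow> exp (theta * t) * (theta * t) * 0"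
    by (intro tendsto_mult tendsto_const summable_LIMSEQ_zero[OF sums_summable[OF exp_converges]])
  then have lim: "(\<lambda>n. exp (theta * t) * (theta * t) * ((theta * t) ^ n /\<^sub>R fact n)) \<longlonglongrightarrow> 0"
    by simp
  have "(\<lambda>n. exp (theta * t) * P t x y -
      (\<Sum>i\<le>n. (jump ^^ i) (\<lambda>z. of_bool (z = y)) x * (theta * t) ^ i / fact i)) \<longlonglongrightarrow> 0"
    by (rule Lim_null_comparison[OF always_eventually lim]) (rule allI, rule bound)
  then have "(\<lambda>n. exp (theta * t) * P t x y - (exp (theta * t) * P t x y -
      (\<Sum>i\<le>n. (jump ^^ i) (\<lambda>z. of_bool (z = y)) x * (theta * t) ^ i / fact i))) \<longlonglongrightarrow> exp (theta * t) * P t x y - 0"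
    by (intro tendsto_diff tendsto_const)
  then show ?thesis
    by (simp add: sums_def_le)
qed

text \<open>
  Averaging the error \<open>B * decay ^ n\<close> over a Poisson number \<open>n\<close> of steps with mean \<open>theta * t\<close>
  gives \<open>B * exp (- theta * (1 - decay) * t)\<close>.
\<close>

lemma P_tendsto_weight:
  assumes x: "x \<in> queue_states" and y: "y \<in> queue_states"
  shows "((\<lambda>t. P t x y) \<longlongrightarrow> weight y) at_top"
proof -
  let ?a = "\<lambda>n. (jump ^^ n) (\<lambda>z. of_bool (z = y)) x :: real"
  obtain B where B: "\<And>n. norm (?a n - weight y) \<le> B * decay ^ n"
    using jump_iter_geometric[OF tame_indicator x] unfolding weight_def by metis
  have exp: "(\<lambda>n. u ^ n / fact n) sums exp u" for u :: real
    using exp_converges[of u] by (simp add: divide_inverse mult.commute)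
  have bound: "norm (P t x y - weight y) \<le> B * exp (- (theta * (1 - decay)) * t)" if t: "t \<ge> 0" for t
  proof -
    let ?s = "theta * t"
    have "norm (exp ?s * P t x y - weight y * exp ?s) \<le> B * exp (decay * ?s)"
    proof (rule norm_sums_le)
      show "(\<lambda>n. ?a n * ?s ^ n / fact n - weight y * (?s ^ n / fact n)) sums (exp ?s * P t x y - weight y * exp ?s)"
        by (intro sums_diff uniformization t x y sums_mult exp)
      show "(\<lambda>n. B * ((decay * ?s) ^ n / fact n)) sums (B * exp (decay * ?s))"
        by (intro sums_mult exp)
      fix n
      have "?a n * ?s ^ n / fact n - weight y * (?s ^ n / fact n) = (?a n - weight y) * (?s ^ n / fact n)"
        by (simp add: left_diff_distrib diff_divide_distrib)
      then have "norm (?a n * ?s ^ n / fact n - weight y * (?s ^ n / fact n)) =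
          norm (?a n - weight y) * (?s ^ n / fact n)"
        using t theta_pos by (simp only: norm_mult) simp
      also have "\<dots> \<le> B * decay ^ n * (?s ^ n / fact n)"
        using t theta_pos by (intro mult_right_mono B) auto
      finally show "norm (?a n * ?s ^ n / fact n - weight y * (?s ^ n / fact n)) \<le> B * ((decay * ?s) ^ n / fact n)"
        by (simp add: power_mult_distrib)
    qed
    also have "exp ?s * P t x y - weight y * exp ?s = exp ?s * (P t x y - weight y)"
      by (simp add: algebra_simps)
    finally have "exp ?s * norm (P t x y - weight y) \<le> B * exp (decay * ?s)"
      by (simp only: norm_mult real_norm_def abs_exp_cancel)
    then have "norm (P t x y - weight y) \<le> B * exp (decay * ?s) / exp ?s"
      by (simp only: pos_le_divide_eq exp_gt_zero mult.commute)
    also have "\<dots> = B * exp (- (theta * (1 - decay)) * t)"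
    proof -
      have "- (theta * (1 - decay)) * t = decay * ?s - ?s"
        by (simp add: algebra_simps)
      then show ?thesis by (simp only: exp_diff times_divide_eq_right)
    qed
    finally show ?thesis .
  qed
  have "filterlim (\<lambda>t. - (theta * (1 - decay)) * t) at_bot at_top"
    using theta_pos decay_lt_1 by (intro filterlim_tendsto_neg_mult_at_bot[OF tendsto_const _ filterlim_ident]) auto
  then have "((\<lambda>t. exp (- (theta * (1 - decay)) * t)) \<longlongrightarrow> 0) at_top"
    by (rule filterlim_compose[OF exp_at_bot])
  then have lim: "((\<lambda>t. B * exp (- (theta * (1 - decay)) * t)) \<longlongrightarrow> 0) at_top"
    by (rule tendsto_mult_right_zero)
  have "((\<lambda>t. P t x y - weight y) \<longlongrightarrow> 0) at_top"
    by (rule Lim_null_comparison[OF eventually_mono[OF eventually_ge_at_top bound] lim])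
  then show ?thesis by (simp add: LIM_zero_iff)
qed

end

end

section \<open>Convergence of the law of the queue\<close>

text \<open>
  The convergence of the transition probabilities need not be uniform in the starting state, so the
  initial law is first confined to a finite set of probability close to one.
\<close>

lemma markov_chain_tendsto:
  assumes "countable S" and prob: "prob_space M"
    and meas: "\<And>t. t \<ge> 0 \<Longrightarrow> X t \<in> measurable M (count_space S)"
    and joint: "\<And>t x. t \<ge> 0 \<Longrightarrow> x \<in> S \<Longrightarrow>
      measure M {w \<in> space M. X 0 w = x \<and> X t w = y} = measure M {w \<in> space M. X 0 w = x} * P t x y"
    and lim: "\<And>x. x \<in> S \<Longrightarrow> ((\<lambda>t. P t x y) \<longlongrightarrow> c) at_top"
    and y: "y \<in> S"
  shows "((\<lambda>t::real. measure M {w \<in> space M. X t w = y}) \<longlongrightarrow> c) at_top"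
  unfolding tendsto_iff
proof (intro allI impI)
  interpret prob_space M by fact
  have ev: "{w \<in> space M. X t w \<in> A} \<in> events" if "t \<ge> 0" for t A
  proof -
    have "X t -` (A \<inter> S) \<inter> space M \<in> events"
      using meas[OF that] by (rule measurable_sets) simp
    moreover have "X t -` (A \<inter> S) \<inter> space M = {w \<in> space M. X t w \<in> A}"
      using measurable_space[OF meas[OF that]] by auto
    ultimately show ?thesis by simp
  qed
  fix e :: real assume e: "e > 0"
  define F where "F n = from_nat_into S ` {..n}" for n :: nat
  define A where "A n = {w \<in> space M. X 0 w \<in> F n}" for n
  have S: "S \<noteq> {}" using y by auto
  have F: "finite (F n)" "F n \<subseteq> S" for n
    using from_nat_into[OF S] by (auto simp: F_def)
  have "(\<lambda>n. prob (A n)) \<longlonglongrightarrow> prob (\<Union>n. A n)"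
    by (rule finite_Lim_measure_incseq)
      (use ev[of 0] in \<open>auto simp: A_def F_def incseq_def\<close>)
  moreover have "(\<Union>n. A n) = space M"
  proof -
    have "X 0 w \<in> F (to_nat_on S (X 0 w))" if "w \<in> space M" for w
      using measurable_space[OF meas[of 0] that] \<open>countable S\<close>
      by (auto simp: F_def intro!: image_eqI[of _ _ "to_nat_on S (X 0 w)"])
    then show ?thesis by (auto simp: A_def)
  qed
  ultimately have "(\<lambda>n. prob (A n)) \<longlonglongrightarrow> 1" by (simp add: prob_space)
  \<comment> \<open>The excluded mass costs at most \<open>1 - a\<close> in the probability and \<open>(1 - a) * \<bar>c\<bar>\<close> in the limit.\<close>
  moreover have "1 - e / (2 * (1 + \<bar>c\<bar>)) < 1" using e by simp
  ultimately have "\<forall>\<^sub>F n in sequentially. 1 - e / (2 * (1 + \<bar>c\<bar>)) < prob (A n)"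
    by (rule order_tendstoD)
  then obtain n where n: "1 - e / (2 * (1 + \<bar>c\<bar>)) < prob (A n)"
    using eventually_happens'[OF sequentially_bot] by blast
  define a where "a = prob (A n)"
  have a: "a \<le> 1" "(1 - a) * (1 + \<bar>c\<bar>) < e / 2"
    using n by (auto simp: a_def field_simps)
  define s where "s t = (\<Sum>x\<in>F n. prob {w \<in> space M. X 0 w = x} * P t x y)" for t
  have mass: "a = (\<Sum>x\<in>F n. prob {w \<in> space M. X 0 w = x})"
  proof -
    have "A n = (\<Union>x\<in>F n. {w \<in> space M. X 0 w = x})" by (auto simp: A_def)
    then show ?thesis
      unfolding a_def
      by (simp, intro finite_measure_finite_Union)
        (use F ev[of 0 "{_}"] in \<open>auto simp: disjoint_family_on_def\<close>)
  qed
  have s_eq: "s t = prob {w \<in> space M. X 0 w \<in> F n \<and> X t w = y}" if t: "t \<ge> 0" for t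
  proof -
    have ev2: "{w \<in> space M. X 0 w = x \<and> X t w = y} \<in> events" for x
    proof -
      have "{w \<in> space M. X 0 w = x \<and> X t w = y} =
          {w \<in> space M. X 0 w \<in> {x}} \<inter> {w \<in> space M. X t w \<in> {y}}" by auto
      then show ?thesis using ev[of 0 "{x}"] ev[OF t, of "{y}"] by (simp add: sets.Int)
    qed
    have "{w \<in> space M. X 0 w \<in> F n \<and> X t w = y} = (\<Union>x\<in>F n. {w \<in> space M. X 0 w = x \<and> X t w = y})"
      by auto
    then have "prob {w \<in> space M. X 0 w \<in> F n \<and> X t w = y} =
        (\<Sum>x\<in>F n. prob {w \<in> space M. X 0 w = x \<and> X t w = y})"
      by (simp, intro finite_measure_finite_Union)
        (use F ev2 in \<open>auto simp: disjoint_family_on_def\<close>)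
    also have "\<dots> = s t"
      unfolding s_def using F(2) t by (intro sum.cong refl joint) auto
    finally show ?thesis by simp
  qed
  have near: "\<bar>prob {w \<in> space M. X t w = y} - s t\<bar> \<le> 1 - a" if t: "t \<ge> 0" for t
  proof -
    let ?E = "{w \<in> space M. X t w \<in> {y}}"
    have E: "?E \<in> events" "A n \<in> events" using ev[OF t, of "{y}"] ev[of 0 "F n"] by (simp_all add: A_def)
    have "prob ?E = prob (?E \<inter> A n) + prob (?E - A n)"
      using E by (simp add: finite_measure_Diff' )
    moreover have "?E \<inter> A n = {w \<in> space M. X 0 w \<in> F n \<and> X t w = y}" by (auto simp: A_def)
    moreover have "prob (?E - A n) \<le> prob (space M - A n)"
      using E by (intro finite_measure_mono) auto
    moreover have "prob (space M - A n) = 1 - a"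
      using E by (simp add: prob_compl a_def)
    ultimately show ?thesis
      using s_eq[OF t] by (simp add: measure_nonneg)
  qed
  have "(s \<longlongrightarrow> (\<Sum>x\<in>F n. prob {w \<in> space M. X 0 w = x} * c)) at_top"
    unfolding s_def using F(2) by (intro tendsto_sum tendsto_mult_left lim) auto
  then have "(s \<longlongrightarrow> a * c) at_top"
    by (simp add: mass sum_distrib_right)
  then have "\<forall>\<^sub>F t in at_top. dist (s t) (a * c) < e / 2"
    using e by (intro tendstoD) auto
  then show "\<forall>\<^sub>F t in at_top. dist (prob {w \<in> space M. X t w = y}) c < e"
    using eventually_ge_at_top[of 0]
  proof eventually_elim
    case (elim t)
    have "\<bar>a * c - c\<bar> = (1 - a) * \<bar>c\<bar>"
    proof -
      have "a * c - c = - ((1 - a) * c)" by (simp add: left_diff_distrib)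
      then show ?thesis using a(1) by (simp add: abs_mult)
    qed
    moreover have "(1 - a) * (1 + \<bar>c\<bar>) = (1 - a) + (1 - a) * \<bar>c\<bar>"
      by (simp add: distrib_left)
    ultimately show ?case
      using near[OF elim(2)] elim(1) a(2) unfolding dist_real_def by linarith
  qed
qed

context stable_queue
begin

lemma prob_at_tendsto:
  assumes queue: "priority_queue l1 l2 mu M N1 N2 xi"
    and y: "(i, j, k) \<in> queue_states"
  shows "((\<lambda>t. prob_at M N1 N2 xi t i j k) \<longlongrightarrow> weight (i, j, k)) at_top"
proof -
  let ?X = "\<lambda>t w. (N1 t w, N2 t w, xi t w)"
  have chain: "markov_chain queue_states (queue_rate l1 l2 mu) M ?X"
    using queue by (simp add: priority_queue_def)
  then obtain P where P: "transition_function queue_states P"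
      "has_transition_rates queue_states (queue_rate l1 l2 mu) P"
    and law: "\<forall>s\<ge>0. \<forall>t\<ge>0. \<forall>x\<in>queue_states. \<forall>y\<in>queue_states. \<forall>T g. finite T \<and> T \<subseteq> {0..<s} \<longrightarrow>
        measure M {w \<in> space M. (\<forall>u\<in>T. ?X u w = g u) \<and> ?X s w = x \<and> ?X (s + t) w = y} =
        measure M {w \<in> space M. (\<forall>u\<in>T. ?X u w = g u) \<and> ?X s w = x} * P t x y"
    unfolding markov_chain_def by (elim conjE exE)
  have "((\<lambda>t. measure M {w \<in> space M. ?X t w = (i, j, k)}) \<longlongrightarrow> weight (i, j, k)) at_top"
  proof (rule markov_chain_tendsto)
    show "countable queue_states" by simp
    show "prob_space M" "\<And>t. 0 \<le> t \<Longrightarrow> ?X t \<in> M \<rightarrow>\<^sub>M count_space queue_states"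
      using chain by (simp_all add: markov_chain_def)
    show "measure M {w \<in> space M. ?X 0 w = x \<and> ?X t w = (i, j, k)} =
        measure M {w \<in> space M. ?X 0 w = x} * P t x (i, j, k)" if "t \<ge> 0" "x \<in> queue_states" for t x
      using bspec[OF bspec[OF law[THEN spec, of 0, simplified, THEN spec, of t, THEN mp, OF that(1)] that(2)] y]
      by simp
    show "((\<lambda>t. P t x (i, j, k)) \<longlongrightarrow> weight (i, j, k)) at_top" if "x \<in> queue_states" for x
      by (rule P_tendsto_weight[OF P that y])
  qed (rule y)
  then show ?thesis by (simp add: prob_at_def)
qed

end

lemma
  assumes queue: "priority_queue l1 l2 mu M N1 N2 xi" and t: "t \<ge> 0"
  shows numbers_prob_at_eq: "numbers_prob_at M N1 N2 t i j =
    prob_at M N1 N2 xi t i j 0 + prob_at M N1 N2 xi t i j 1 + prob_at M N1 N2 xi t i j 2"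
    and prob_at_outside: "(i, j, k) \<notin> queue_states \<Longrightarrow> prob_at M N1 N2 xi t i j k = 0"
proof -
  let ?X = "\<lambda>w. (N1 t w, N2 t w, xi t w)"
  have chain: "prob_space M" and X: "?X \<in> M \<rightarrow>\<^sub>M count_space queue_states"
    using queue t by (auto simp: priority_queue_def markov_chain_def)
  interpret prob_space M by fact
  have in_states: "?X w \<in> queue_states" if "w \<in> space M" for w
    using measurable_space[OF X that] by simp
  show "prob_at M N1 N2 xi t i j k = 0" if "(i, j, k) \<notin> queue_states"
  proof -
    have "{w \<in> space M. N1 t w = i \<and> N2 t w = j \<and> xi t w = k} = {}"
      using in_states that by auto
    then show ?thesis by (simp only: prob_at_def measure_empty)
  qed
  let ?E = "\<lambda>k. {w \<in> space M. N1 t w = i \<and> N2 t w = j \<and> xi t w = k}"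
  have ev: "?E k \<in> events" for k
  proof -
    have "?X -` ({(i, j, k)} \<inter> queue_states) \<inter> space M \<in> events"
      using X by (rule measurable_sets) simp
    moreover have "?X -` ({(i, j, k)} \<inter> queue_states) \<inter> space M = ?E k"
      using in_states by auto
    ultimately show ?thesis by simp
  qed
  have "{w \<in> space M. N1 t w = i \<and> N2 t w = j} = (\<Union>k\<in>{0, 1, 2}. ?E k)"
  proof -
    have "xi t w \<in> {0, 1, 2}" if "w \<in> space M" for w
      using in_states[OF that] by (auto simp: queue_states_iff)
    then show ?thesis by blast
  qed
  then have "numbers_prob_at M N1 N2 t i j = (\<Sum>k\<in>{0, 1, 2}. prob (?E k))"
    unfolding numbers_prob_at_def
    by (simp only:, intro finite_measure_finite_Union) (use ev in \<open>auto simp: disjoint_family_on_def\<close>)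
  then show "numbers_prob_at M N1 N2 t i j =
    prob_at M N1 N2 xi t i j 0 + prob_at M N1 N2 xi t i j 1 + prob_at M N1 N2 xi t i j 2"
    by (simp add: prob_at_def)
qed

section \<open>The stationary generating functions\<close>

theorem mainTheorem1:
  fixes l1 l2 mu :: real
    and M :: "'w measure"
    and N1 N2 xi :: "real \<Rightarrow> 'w \<Rightarrow> nat"
    and p :: "nat \<Rightarrow> nat \<Rightarrow> nat \<Rightarrow> real"
    and q :: "nat \<Rightarrow> nat \<Rightarrow> real"
    and f :: "complex \<Rightarrow> complex"
  assumes pos: "l1 > 0" "l2 > 0" "mu > 0"
    and rho: "(l1 + l2) / mu < 1"
    and queue: "priority_queue l1 l2 mu M N1 N2 xi"
    and p: "p = stationary_prob M N1 N2 xi"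
    and q: "q = stationary_numbers_prob M N1 N2"
    and f: "f = disc_root l1 l2 mu"
  shows "(\<forall>i j k. ((\<lambda>t. prob_at M N1 N2 xi t i j k) \<longlongrightarrow> p i j k) at_top) \<and>
    (\<forall>i j. ((\<lambda>t. numbers_prob_at M N1 N2 t i j) \<longlongrightarrow> q i j) at_top) \<and>
    (\<forall>z2::complex. norm z2 < 1 \<longrightarrow> (\<exists>!z1. is_disc_root l1 l2 mu z2 z1)) \<and>
    p 0 0 0 = (mu - l1 - l2) / mu \<and>
    (\<forall>(z1::complex) (z2::complex).
       0 < norm z1 \<and> norm z1 < 1 \<and> 0 < norm z2 \<and> norm z2 < 1 \<and> z1 \<noteq> f z2 \<longrightarrow>
         pgf_class2_alone p z2 =
           (l1 * (1 - f z2) + l2 * (1 - z2) + mu) * (l1 * (1 - f z2) + l2 * (1 - z2)) /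
           ((mu / z2 - (l1 * (1 - f z2) + l2 * (1 - z2) + mu)) * (l1 + l2 * (1 - z2) + mu)) *
           p 0 0 0 \<and>
         pgf_class2 p z1 z2 =
           (l1 + l2 * (1 - z2) + mu) * pgf_class2_alone p z2 /
           (l1 * (1 - z1) + l2 * (1 - z2) + mu) \<and>
         pgf_class1 p z1 z2 =
           ((l1 + l2 * (1 - z2) + mu) *
              (mu / z2 * (1 / (l1 * (1 - z1) + l2 * (1 - z2) + mu)) - 1) *
              pgf_class2_alone p z2 -
            (l1 * (1 - z1) + l2 * (1 - z2)) * p 0 0 0) /
           (l1 * (1 - z1) + l2 * (1 - z2) + mu * (1 - 1 / z1))) \<and>
    (\<forall>(z1::complex) (z2::complex). norm z1 \<le> 1 \<and> norm z2 \<le> 1 \<longrightarrow>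
       joint_pgf q z1 z2 = pgf_class1 p z1 z2 + pgf_class2 p z1 z2 + p 0 0 0)"
proof -
  interpret stable_queue l1 l2 mu
    using pos rho by unfold_locales (simp_all add: field_simps)
  have p_lim: "((\<lambda>t. prob_at M N1 N2 xi t i j k) \<longlongrightarrow>
      (if (i, j, k) \<in> queue_states then weight (i, j, k) else 0)) at_top" for i j k
  proof (cases "(i, j, k) \<in> queue_states")
    case True
    then show ?thesis using prob_at_tendsto[OF queue True] by simp
  next
    case False
    have "\<forall>\<^sub>F t in at_top. 0 = prob_at M N1 N2 xi t i j k"
      using eventually_ge_at_top[of 0]
      by eventually_elim (simp add: prob_at_outside[OF queue _ False])
    then have "((\<lambda>t. prob_at M N1 N2 xi t i j k) \<longlongrightarrow> 0) at_top"
      by (rule Lim_transform_eventually[OF tendsto_const])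
    then show ?thesis using False by simp
  qed
  have p_eq: "p i j k = (if (i, j, k) \<in> queue_states then weight (i, j, k) else 0)" for i j k
    unfolding p stationary_prob_def by (rule tendsto_Lim[OF trivial_limit_at_top_linorder p_lim])
  have p_tendsto: "((\<lambda>t. prob_at M N1 N2 xi t i j k) \<longlongrightarrow> p i j k) at_top" for i j k
    unfolding p_eq by (rule p_lim)
  have q_lim: "((\<lambda>t. numbers_prob_at M N1 N2 t i j) \<longlongrightarrow> p i j 0 + p i j 1 + p i j 2) at_top" for i j
  proof (rule Lim_transform_eventually)
    show "((\<lambda>t. prob_at M N1 N2 xi t i j 0 + prob_at M N1 N2 xi t i j 1 + prob_at M N1 N2 xi t i j 2)
        \<longlongrightarrow> p i j 0 + p i j 1 + p i j 2) at_top"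
      by (intro tendsto_add p_tendsto)
    show "\<forall>\<^sub>F t in at_top. prob_at M N1 N2 xi t i j 0 + prob_at M N1 N2 xi t i j 1 +
        prob_at M N1 N2 xi t i j 2 = numbers_prob_at M N1 N2 t i j"
      using eventually_ge_at_top[of 0]
      by eventually_elim (simp only: numbers_prob_at_eq[OF queue])
  qed
  have q_eq: "q i j = p i j 0 + p i j 1 + p i j 2" for i j
    unfolding q stationary_numbers_prob_def by (rule tendsto_Lim[OF trivial_limit_at_top_linorder q_lim])
  have p_in: "p i j k = weight (i, j, k)" if "(i, j, k) \<in> queue_states" for i j k
    using that by (simp add: p_eq)
  have p0: "p 0 0 0 = weight (0, 0, 0)"
    by (rule p_in) simp
  show ?thesis
  proof (intro conjI allI impI)
    show "((\<lambda>t. prob_at M N1 N2 xi t i j k) \<longlongrightarrow> p i j k) at_top" for i j k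
      by (rule p_tendsto)
    show "((\<lambda>t. numbers_prob_at M N1 N2 t i j) \<longlongrightarrow> q i j) at_top" for i j
      unfolding q_eq by (rule q_lim)
    show "\<exists>!z1. is_disc_root l1 l2 mu z2 z1" if "norm z2 < 1" for z2
      using that by (rule disc_root_unique)
    show "p 0 0 0 = (mu - l1 - l2) / mu"
      unfolding p0 by (rule weight_empty)
    show "joint_pgf q z1 z2 = pgf_class1 p z1 z2 + pgf_class2 p z1 z2 + p 0 0 0"
      if "norm z1 \<le> 1 \<and> norm z2 \<le> 1" for z1 z2
      using that by (intro joint_pgf_eq p_eq q_eq) auto
  next
    fix z1 z2 :: complex
    assume "0 < norm z1 \<and> norm z1 < 1 \<and> 0 < norm z2 \<and> norm z2 < 1 \<and> z1 \<noteq> f z2"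
    then have z: "norm z1 < 1" "norm z2 < 1" "z1 \<noteq> 0" "z2 \<noteq> 0" "z1 \<noteq> disc_root l1 l2 mu z2"
      by (auto simp: f)
    have f_z2: "f z2 = disc_root l1 l2 mu z2" by (simp add: f)
    have W: "complex_of_real (p 0 0 0) = weight (0, 0, 0)" by (simp add: p0)
    note pgf = pgf_class1_eq[of p, OF p_in z(1,2)] pgf_class2_eq[of p, OF p_in z(1,2)]
      pgf_class2_alone_eq[of p, OF p_in z(2)]
    note formulas = generating_functions[OF z f_z2 W pgf(3)]
    show "pgf_class2_alone p z2 =
           (l1 * (1 - f z2) + l2 * (1 - z2) + mu) * (l1 * (1 - f z2) + l2 * (1 - z2)) /
           ((mu / z2 - (l1 * (1 - f z2) + l2 * (1 - z2) + mu)) * (l1 + l2 * (1 - z2) + mu)) *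
           p 0 0 0"
      by (rule formulas(1))
    show "pgf_class2 p z1 z2 =
           (l1 + l2 * (1 - z2) + mu) * pgf_class2_alone p z2 /
           (l1 * (1 - z1) + l2 * (1 - z2) + mu)"
      using formulas(2) by (simp only: pgf(2))
    show "pgf_class1 p z1 z2 =
           ((l1 + l2 * (1 - z2) + mu) *
              (mu / z2 * (1 / (l1 * (1 - z1) + l2 * (1 - z2) + mu)) - 1) *
              pgf_class2_alone p z2 -
            (l1 * (1 - z1) + l2 * (1 - z2)) * p 0 0 0) /
           (l1 * (1 - z1) + l2 * (1 - z2) + mu * (1 - 1 / z1))"
      using formulas(3) by (simp only: pgf(1))
  qed
qed

end
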